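(* Let $1\le p<\infty$, let $d\ge 1$, let $\mathcal{X}$ be a reflexive Banach space and $\mathcal{Y}_1,\dots,\mathcal{Y}_d$ Banach spaces over $\mathbb{F}$. Let $\mathcal{T}=(T_1,\dots,T_d)$ and $\mathcal{S}=(S_1,\dots,S_d)$ belong to $\mathcal{K}(\mathcal{X},\ell_p^d(\mathcal{Y}_k))$, with $\mathcal{T}\notin\mathbb{F}^d\mathcal{S}$. Let $\mathbf{z}^0=(z_1^0,\dots,z_d^0)\in\mathbb{F}^d$, $\mathcal{T}^0=\mathcal{T}-\mathbf{z}^0\mathcal{S}$ and $T_j^0=T_j-z_j^0S_j$. Suppose that $dist(\mathcal{T},\mathbb{F}^d\mathcal{S})=\|\mathcal{T}^0\|$ and that $\mathcal{T}^0$ is smooth in $\mathcal{K}(\mathcal{X},\ell_p^d(\mathcal{Y}_k))$. Then there exists $x\in M_{\mathcal{T}^0}\cap E_{\mathcal{X}}$ such that \[dist(T_jx,\mathbb{F}S_jx)=\|T_j^0x\|\quad\text{for all }1\le j\le d,\] and \[dist(\mathcal{T},\mathbb{F}^d\mathcal{S})^p=\sum_{j=1}^d dist(T_jx,\mathbb{F}S_jx)^p.\]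
   Context: $\mathbb{F}$ is $\mathbb{R}$ or $\mathbb{C}$. $\ell_p^d(\mathcal{Y}_k)$ is the direct sum $\mathcal{Y}_1\oplus\cdots\oplus\mathcal{Y}_d$ with norm $\|(y_1,\dots,y_d)\|_p=(\sum_{i=1}^d\|y_i\|^p)^{1/p}$. $\mathcal{K}(\mathcal{X},\mathcal{Y})$ is the space of compact linear operators from $\mathcal{X}$ to $\mathcal{Y}$ with the operator norm. A tuple $\mathcal{T}=(T_1,\dots,T_d)$ with $T_k:\mathcal{X}\to\mathcal{Y}_k$ is identified with the operator $x\mapsto(T_1x,\dots,T_dx)$ into $\ell_p^d(\mathcal{Y}_k)$, and $\|\mathcal{T}\|$ is its operator norm. For $\mathbf{z}=(z_1,\dots,z_d)\in\mathbb{F}^d$, $\mathbf{z}\mathcal{S}=(z_1S_1,\dots,z_dS_d)$, and $\mathbb{F}^d\mathcal{S}=\{\mathbf{z}\mathcal{S}:\mathbf{z}\in\mathbb{F}^d\}$; for a vector $y$, $\mathbb{F}y=\{zy:z\in\mathbb{F}\}$. For an element $x$ and a subspace $W$ of a Banach space, $dist(x,W)=\inf\{\|x-w\|:w\in W\}$. $S_{\mathcal{X}}$ is the unit sphere and $E_{\mathcal{X}}$ the set of extreme points of the closed unit ball of $\mathcal{X}$. $M_T=\{x\in S_{\mathcal{X}}:\|Tx\|=\|T\|\}$ is the norm attainment set of an operator $T$ on $\mathcal{X}$. A nonzero element $x$ of a Banach space $\mathcal{Z}$ is smooth if $J(x)=\{f\in\mathcal{Z}^*:\|f\|=1,\ f(x)=\|x\|\}$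 is a singleton. *)

theory Defs
  imports "HOL-Analysis.Analysis" "HOL-Algebra.Module"
begin

text \<open>
  The scalar field is a subset \<open>F\<close> of the complex numbers, either \<open>\<real>\<close> or \<open>UNIV\<close>.  A vector space over
  \<open>F\<close> is a HOL-Algebra module over \<open>scalar_ring F\<close>; a normed space additionally carries a norm.
  Working with carriers allows a family of pairwise different spaces \<open>Y 1, \<dots>, Y d\<close>, and makes
  operator spaces, duals and \<open>p\<close>-sums (for varying real \<open>p\<close>) spaces of the same kind.  The ring
  multiplication and unit present in the module record play no role here.
\<close>

definition scalar_ring :: "complex set \<Rightarrow> complex ring" where
  "scalar_ring F = \<lparr>carrier = F, mult = (*), one = 1, zero = 0, add = (+)\<rparr>"

record 'a normed_module = "(complex, 'a) module" +
  vnorm :: "'a \<Rightarrow> real" (\<open>\<parallel>_\<parallel>\<index>\<close>)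

locale normed_space = Module.module "scalar_ring F" V
  for F :: "complex set" and V :: "'a normed_module" (structure) +
  assumes scalar_field: "F = \<real> \<or> F = UNIV"
    and vnorm_eq_zeroD: "x \<in> carrier V \<Longrightarrow> \<parallel>x\<parallel> = 0 \<Longrightarrow> x = \<zero>"
    and vnorm_smult: "c \<in> F \<Longrightarrow> x \<in> carrier V \<Longrightarrow> \<parallel>c \<odot> x\<parallel> = cmod c * \<parallel>x\<parallel>"
    and vnorm_triangle: "x \<in> carrier V \<Longrightarrow> y \<in> carrier V \<Longrightarrow> \<parallel>x \<oplus> y\<parallel> \<le> \<parallel>x\<parallel> + \<parallel>y\<parallel>"

text \<open>
  The locale \<^locale>\<open>Metric_space\<close> wants a nonnegative symmetric function on the whole type, hence the
  value \<open>0\<close> off the carrier.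
\<close>

definition vdist :: "'a normed_module \<Rightarrow> 'a \<Rightarrow> 'a \<Rightarrow> real" where
  "vdist V x y = (if x \<in> carrier V \<and> y \<in> carrier V then \<parallel>x \<ominus>\<^bsub>V\<^esub> y\<parallel>\<^bsub>V\<^esub> else 0)"

definition norm_topology :: "'a normed_module \<Rightarrow> 'a topology" where
  "norm_topology V = Metric_space.mtopology (carrier V) (vdist V)"

definition banach_space :: "complex set \<Rightarrow> 'a normed_module \<Rightarrow> bool" where
  "banach_space F V \<longleftrightarrow> normed_space F V \<and> Metric_space.mcomplete (carrier V) (vdist V)"

definition unit_ball :: "'a normed_module \<Rightarrow> 'a set" where
  "unit_ball V = {x \<in> carrier V. \<parallel>x\<parallel>\<^bsub>V\<^esub> \<le> 1}"

definition unit_sphere :: "'a normed_module \<Rightarrow> 'a set" where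
  "unit_sphere V = {x \<in> carrier V. \<parallel>x\<parallel>\<^bsub>V\<^esub> = 1}"

definition ball_extreme_points :: "'a normed_module \<Rightarrow> 'a set" where
  "ball_extreme_points V =
    {x \<in> unit_ball V. \<forall>a \<in> unit_ball V. \<forall>b \<in> unit_ball V. \<forall>t::real. 0 < t \<and> t < 1 \<and>
       x = complex_of_real (1 - t) \<odot>\<^bsub>V\<^esub> a \<oplus>\<^bsub>V\<^esub> complex_of_real t \<odot>\<^bsub>V\<^esub> b \<longrightarrow> a = b}"

definition dist_to :: "'a normed_module \<Rightarrow> 'a \<Rightarrow> 'a set \<Rightarrow> real" where
  "dist_to V x W = (INF w\<in>W. \<parallel>x \<ominus>\<^bsub>V\<^esub> w\<parallel>\<^bsub>V\<^esub>)"

definition line :: "complex set \<Rightarrow> 'a normed_module \<Rightarrow> 'a \<Rightarrow> 'a set" where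
  "line F V y = (\<lambda>z. z \<odot>\<^bsub>V\<^esub> y) ` F"

definition scalar_space :: "complex set \<Rightarrow> complex normed_module" where
  "scalar_space F = \<lparr>carrier = F, mult = (*), one = 1, zero = 0, add = (+), smult = (*), vnorm = cmod\<rparr>"

text \<open>
  Maps between carriers are taken \<^const>\<open>extensional\<close>, so that HOL equality is equality on the
  carrier; in particular ``is a singleton'' has its intended meaning for sets of functionals.
\<close>

definition linear_ops :: "complex set \<Rightarrow> 'a normed_module \<Rightarrow> 'b normed_module \<Rightarrow> ('a \<Rightarrow> 'b) set" where
  "linear_ops F V W =
    {T \<in> carrier V \<rightarrow>\<^sub>E carrier W.
       (\<forall>x \<in> carrier V. \<forall>y \<in> carrier V. T (x \<oplus>\<^bsub>V\<^esub> y) = T x \<oplus>\<^bsub>W\<^esub> T y) \<and>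
       (\<forall>c \<in> F. \<forall>x \<in> carrier V. T (c \<odot>\<^bsub>V\<^esub> x) = c \<odot>\<^bsub>W\<^esub> T x)}"

definition bounded_ops :: "complex set \<Rightarrow> 'a normed_module \<Rightarrow> 'b normed_module \<Rightarrow> ('a \<Rightarrow> 'b) set" where
  "bounded_ops F V W =
    {T \<in> linear_ops F V W. \<exists>B. \<forall>x \<in> carrier V. \<parallel>T x\<parallel>\<^bsub>W\<^esub> \<le> B * \<parallel>x\<parallel>\<^bsub>V\<^esub>}"

definition compact_ops :: "complex set \<Rightarrow> 'a normed_module \<Rightarrow> 'b normed_module \<Rightarrow> ('a \<Rightarrow> 'b) set" where
  "compact_ops F V W =
    {T \<in> linear_ops F V W. compactin (norm_topology W) (norm_topology W closure_of (T ` unit_ball V))}"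

definition op_norm :: "'a normed_module \<Rightarrow> 'b normed_module \<Rightarrow> ('a \<Rightarrow> 'b) \<Rightarrow> real" where
  "op_norm V W T = (SUP x\<in>unit_ball V. \<parallel>T x\<parallel>\<^bsub>W\<^esub>)"

definition op_space ::
    "'a normed_module \<Rightarrow> 'b normed_module \<Rightarrow> ('a \<Rightarrow> 'b) set \<Rightarrow> ('a \<Rightarrow> 'b) normed_module" where
  "op_space V W A =
    \<lparr>carrier = A, mult = undefined, one = undefined,
     zero = (\<lambda>x \<in> carrier V. \<zero>\<^bsub>W\<^esub>),
     add = (\<lambda>S T. \<lambda>x \<in> carrier V. S x \<oplus>\<^bsub>W\<^esub> T x),
     smult = (\<lambda>c T. \<lambda>x \<in> carrier V. c \<odot>\<^bsub>W\<^esub> T x),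
     vnorm = op_norm V W\<rparr>"

definition compact_op_space ::
    "complex set \<Rightarrow> 'a normed_module \<Rightarrow> 'b normed_module \<Rightarrow> ('a \<Rightarrow> 'b) normed_module" where
  "compact_op_space F V W = op_space V W (compact_ops F V W)"

definition dual :: "complex set \<Rightarrow> 'a normed_module \<Rightarrow> ('a \<Rightarrow> complex) normed_module" where
  "dual F V = op_space V (scalar_space F) (bounded_ops F V (scalar_space F))"

definition reflexive :: "complex set \<Rightarrow> 'a normed_module \<Rightarrow> bool" where
  "reflexive F V \<longleftrightarrow>
    (\<forall>\<phi> \<in> carrier (dual F (dual F V)). \<exists>x \<in> carrier V. \<forall>f \<in> carrier (dual F V). \<phi> f = f x)"

definition support_functionals ::
    "complex set \<Rightarrow> 'a normed_module \<Rightarrow> 'a \<Rightarrow> ('a \<Rightarrow> complex) set" where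
  "support_functionals F V x =
    {f \<in> carrier (dual F V). \<parallel>f\<parallel>\<^bsub>dual F V\<^esub> = 1 \<and> f x = complex_of_real (\<parallel>x\<parallel>\<^bsub>V\<^esub>)}"

definition smooth :: "complex set \<Rightarrow> 'a normed_module \<Rightarrow> 'a \<Rightarrow> bool" where
  "smooth F V x \<longleftrightarrow> x \<in> carrier V \<and> x \<noteq> \<zero>\<^bsub>V\<^esub> \<and> is_singleton (support_functionals F V x)"

definition norm_attainment :: "'a normed_module \<Rightarrow> 'b normed_module \<Rightarrow> ('a \<Rightarrow> 'b) \<Rightarrow> 'a set" where
  "norm_attainment V W T = {x \<in> unit_sphere V. \<parallel>T x\<parallel>\<^bsub>W\<^esub> = op_norm V W T}"

definition lp_sum :: "real \<Rightarrow> nat \<Rightarrow> (nat \<Rightarrow> 'b normed_module) \<Rightarrow> (nat \<Rightarrow> 'b) normed_module" where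
  "lp_sum p d Y =
    \<lparr>carrier = (\<Pi>\<^sub>E k\<in>{1..d}. carrier (Y k)), mult = undefined, one = undefined,
     zero = (\<lambda>k\<in>{1..d}. \<zero>\<^bsub>Y k\<^esub>),
     add = (\<lambda>u v. \<lambda>k\<in>{1..d}. u k \<oplus>\<^bsub>Y k\<^esub> v k),
     smult = (\<lambda>c u. \<lambda>k\<in>{1..d}. c \<odot>\<^bsub>Y k\<^esub> u k),
     vnorm = (\<lambda>u. (\<Sum>k=1..d. \<parallel>u k\<parallel>\<^bsub>Y k\<^esub> powr p) powr (1 / p))\<rparr>"

definition op_tuple :: "'a normed_module \<Rightarrow> nat \<Rightarrow> (nat \<Rightarrow> 'a \<Rightarrow> 'b) \<Rightarrow> 'a \<Rightarrow> nat \<Rightarrow> 'b" where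
  "op_tuple X d T = (\<lambda>x \<in> carrier X. \<lambda>k\<in>{1..d}. T k x)"

definition scale_tuple ::
    "(nat \<Rightarrow> 'b normed_module) \<Rightarrow> (nat \<Rightarrow> complex) \<Rightarrow> (nat \<Rightarrow> 'a \<Rightarrow> 'b) \<Rightarrow> nat \<Rightarrow> 'a \<Rightarrow> 'b" where
  "scale_tuple Y z S = (\<lambda>k x. z k \<odot>\<^bsub>Y k\<^esub> S k x)"

definition diff_tuple ::
    "(nat \<Rightarrow> 'b normed_module) \<Rightarrow> (nat \<Rightarrow> 'a \<Rightarrow> 'b) \<Rightarrow> (nat \<Rightarrow> 'a \<Rightarrow> 'b) \<Rightarrow> nat \<Rightarrow> 'a \<Rightarrow> 'b" where
  "diff_tuple Y T S = (\<lambda>k x. T k x \<ominus>\<^bsub>Y k\<^esub> S k x)"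

text \<open>The set \<open>F\<^sup>d S\<close> of all coordinatewise scalings of the tuple \<open>S\<close>, as operators.\<close>

definition scaled_tuples ::
    "complex set \<Rightarrow> 'a normed_module \<Rightarrow> nat \<Rightarrow> (nat \<Rightarrow> 'b normed_module) \<Rightarrow> (nat \<Rightarrow> 'a \<Rightarrow> 'b)
      \<Rightarrow> ('a \<Rightarrow> nat \<Rightarrow> 'b) set" where
  "scaled_tuples F X d Y S = (\<lambda>z. op_tuple X d (scale_tuple Y z S)) ` ({1..d} \<rightarrow> F)"

end

theory Submission
  imports Defs
begin

text \<open>
  The proof rests on comparing two support functionals at the residual \<open>T\<^sup>0\<close> in the space of compact
  operators.  Since \<open>T\<^sup>0\<close> is at distance \<open>\<parallel>T\<^sup>0\<parallel>\<close> from the subspace \<open>F\<^sup>d S\<close>, the Hahn--Banach theorem yields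
  one that vanishes on that subspace (\<open>best_approximation_functional\<close>).  Since \<open>T\<^sup>0\<close> is compact and the
  domain reflexive, \<open>T\<^sup>0\<close> attains its norm at an extreme point \<open>x\<close> of the unit ball, and if \<open>f\<close> norms \<open>T\<^sup>0 x\<close>,
  then \<open>A \<mapsto> f (A x)\<close> is another one (\<open>compact_op_extreme_norm_attainment\<close>).  By smoothness they agree, so
  \<open>f\<close> vanishes on \<open>A x\<close> for all scaled tuples \<open>A\<close>.  Consequently \<open>\<parallel>T\<^sup>0 x\<parallel> \<le> \<parallel>T\<^sup>0 x + A x\<parallel>\<close> for all such \<open>A\<close>
  (\<open>smooth_best_approximation_pointwise\<close>).

  Choosing \<open>A\<close> concentrated in one coordinate \<open>j\<close> cancels all other terms of the \<open>p\<close>-norm and leaves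
  \<open>\<parallel>T\<^sup>0\<^sub>j x\<parallel> \<le> \<parallel>T\<^sup>0\<^sub>j x + c S\<^sub>j x\<parallel>\<close> for all scalars \<open>c\<close>, which is the first claim.  The second claim is the definition
  of the \<open>p\<close>-norm at \<open>T\<^sup>0 x\<close>, where the operator norm is attained.

  Both Hahn--Banach and the existence of extreme points come from one application of Zorn's lemma to
  sublinear functionals, \<open>extreme_dominated_functional\<close>: below every sublinear functional there is an
  extreme linear one.  Applied to the norm of the dual space, it produces an extreme point of the
  bidual ball, which reflexivity moves into the space itself
  (\<open>extreme_norming_point\<close>).
\<close>

section \<open>Normed spaces over the reals or the complex numbers\<close>

lemma scalar_ring_simps [simp]:
  "carrier (scalar_ring F) = F"
  "a \<otimes>\<^bsub>scalar_ring F\<^esub> b = a * b"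
  "\<one>\<^bsub>scalar_ring F\<^esub> = 1"
  "\<zero>\<^bsub>scalar_ring F\<^esub> = 0"
  "a \<oplus>\<^bsub>scalar_ring F\<^esub> b = a + b"
  by (simp_all add: scalar_ring_def)

lemma cring_scalar_ring:
  assumes "F = \<real> \<or> F = UNIV"
  shows "cring (scalar_ring F)"
proof (rule cringI)
  show "abelian_group (scalar_ring F)"
    using assms by (intro abelian_groupI) (auto simp: algebra_simps intro: bexI[where x = "- x" for x] Reals_minus)
  show "comm_monoid (scalar_ring F)"
    using assms by (intro comm_monoidI) (auto simp: algebra_simps)
qed (simp add: algebra_simps)

text \<open>
  Additive inverses need not be supplied, since \<open>(-1) \<odot> x\<close> is one as soon as \<open>0 \<odot> x = \<zero>\<close>.
\<close>

lemma normed_spaceI: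
  fixes V (structure)
  assumes field: "F = \<real> \<or> F = UNIV"
    and "\<And>x y. x \<in> carrier V \<Longrightarrow> y \<in> carrier V \<Longrightarrow> x \<oplus> y \<in> carrier V"
    and "\<zero> \<in> carrier V"
    and "\<And>x y z. x \<in> carrier V \<Longrightarrow> y \<in> carrier V \<Longrightarrow> z \<in> carrier V \<Longrightarrow> (x \<oplus> y) \<oplus> z = x \<oplus> (y \<oplus> z)"
    and "\<And>x y. x \<in> carrier V \<Longrightarrow> y \<in> carrier V \<Longrightarrow> x \<oplus> y = y \<oplus> x"
    and l_zero: "\<And>x. x \<in> carrier V \<Longrightarrow> \<zero> \<oplus> x = x"
    and smult: "\<And>c x. c \<in> F \<Longrightarrow> x \<in> carrier V \<Longrightarrow> c \<odot> x \<in> carrier V"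
    and zero_smult: "\<And>x. x \<in> carrier V \<Longrightarrow> 0 \<odot> x = \<zero>"
    and l_distr: "\<And>a b x. a \<in> F \<Longrightarrow> b \<in> F \<Longrightarrow> x \<in> carrier V \<Longrightarrow> (a + b) \<odot> x = a \<odot> x \<oplus> b \<odot> x"
    and r_distr: "\<And>a x y. a \<in> F \<Longrightarrow> x \<in> carrier V \<Longrightarrow> y \<in> carrier V \<Longrightarrow> a \<odot> (x \<oplus> y) = a \<odot> x \<oplus> a \<odot> y"
    and smult_assoc: "\<And>a b x. a \<in> F \<Longrightarrow> b \<in> F \<Longrightarrow> x \<in> carrier V \<Longrightarrow> (a * b) \<odot> x = a \<odot> (b \<odot> x)"
    and smult_one: "\<And>x. x \<in> carrier V \<Longrightarrow> 1 \<odot> x = x"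
    and norm: "\<And>x. x \<in> carrier V \<Longrightarrow> \<parallel>x\<parallel> = 0 \<Longrightarrow> x = \<zero>"
      "\<And>c x. c \<in> F \<Longrightarrow> x \<in> carrier V \<Longrightarrow> \<parallel>c \<odot> x\<parallel> = cmod c * \<parallel>x\<parallel>"
      "\<And>x y. x \<in> carrier V \<Longrightarrow> y \<in> carrier V \<Longrightarrow> \<parallel>x \<oplus> y\<parallel> \<le> \<parallel>x\<parallel> + \<parallel>y\<parallel>"
  shows "normed_space F V"
proof -
  have one: "1 \<in> F" "-1 \<in> F"
    using field by auto
  have inverse: "\<exists>y\<in>carrier V. y \<oplus> x = \<zero>" if "x \<in> carrier V" for x
  proof
    show "(-1) \<odot> x \<in> carrier V"
      using smult one that by blast
    show "(-1) \<odot> x \<oplus> x = \<zero>"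
      using l_distr[OF one(2) one(1) that] smult_one[OF that] zero_smult[OF that] by simp
  qed
  have "module (scalar_ring F) V"
    by (intro moduleI cring_scalar_ring abelian_groupI)
       (use assms inverse in auto)
  then show ?thesis
    using norm field by (simp add: normed_space_def normed_space_axioms_def)
qed

context normed_space
begin

lemma of_real_mem [simp, intro]: "complex_of_real r \<in> F"
  using scalar_field by auto

lemma scalars [simp, intro]:
  "0 \<in> F" "1 \<in> F" "-1 \<in> F" "\<And>a b. a \<in> F \<Longrightarrow> b \<in> F \<Longrightarrow> a + b \<in> F"
  "\<And>a b. a \<in> F \<Longrightarrow> b \<in> F \<Longrightarrow> a - b \<in> F"
  "\<And>a b. a \<in> F \<Longrightarrow> b \<in> F \<Longrightarrow> a * b \<in> F" "\<And>a. a \<in> F \<Longrightarrow> - a \<in> F" "\<And>a. a \<in> F \<Longrightarrow> cnj a \<in> F"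
  using scalar_field by (auto simp: Reals_cnj_iff)

lemma smult_simps:
  "c \<in> F \<Longrightarrow> x \<in> carrier V \<Longrightarrow> c \<odot> x \<in> carrier V"
  "a \<in> F \<Longrightarrow> b \<in> F \<Longrightarrow> x \<in> carrier V \<Longrightarrow> (a + b) \<odot> x = a \<odot> x \<oplus> b \<odot> x"
  "a \<in> F \<Longrightarrow> b \<in> F \<Longrightarrow> x \<in> carrier V \<Longrightarrow> a \<odot> (b \<odot> x) = (a * b) \<odot> x"
  "a \<in> F \<Longrightarrow> x \<in> carrier V \<Longrightarrow> y \<in> carrier V \<Longrightarrow> a \<odot> (x \<oplus> y) = a \<odot> x \<oplus> a \<odot> y"
  "x \<in> carrier V \<Longrightarrow> 1 \<odot> x = x"
  "x \<in> carrier V \<Longrightarrow> 0 \<odot> x = \<zero>"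
  "a \<in> F \<Longrightarrow> a \<odot> \<zero> = \<zero>"
  using smult_closed smult_l_distr smult_r_distr smult_assoc1 smult_one smult_l_null smult_r_null
  by simp_all

declare smult_simps(1) [simp, intro]

lemma neg_one_smult:
  assumes "x \<in> carrier V" shows "(-1) \<odot> x = \<ominus> x"
proof -
  have "(-1) \<odot> x \<oplus> x = \<zero>"
    using smult_simps(2)[of "-1" 1 x] assms smult_simps(5,6)[OF assms] by simp
  then show ?thesis
    using assms minus_equality[of "(-1) \<odot> x" x] by simp
qed

lemma minus_as_smult:
  assumes "x \<in> carrier V" "y \<in> carrier V" shows "x \<ominus> y = x \<oplus> (-1) \<odot> y"
  using assms by (simp add: minus_eq neg_one_smult)

lemma vnorm_zero [simp]: "\<parallel>\<zero>\<parallel> = 0"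
  using vnorm_smult[of 0 \<zero>] by (simp add: smult_simps)

lemma vnorm_neg: "x \<in> carrier V \<Longrightarrow> \<parallel>\<ominus> x\<parallel> = \<parallel>x\<parallel>"
  using vnorm_smult[of "-1" x] by (simp add: neg_one_smult)

lemma vnorm_nonneg [simp]:
  assumes "x \<in> carrier V" shows "0 \<le> \<parallel>x\<parallel>"
  using vnorm_triangle[of x "\<ominus> x"] assms by (simp add: vnorm_neg r_neg)

lemma vnorm_minus_commute:
  assumes "x \<in> carrier V" "y \<in> carrier V" shows "\<parallel>x \<ominus> y\<parallel> = \<parallel>y \<ominus> x\<parallel>"
proof -
  have "\<ominus> (x \<ominus> y) = y \<ominus> x"
    using assms by (simp add: minus_eq minus_add a_comm)
  then show ?thesis
    using vnorm_neg[of "x \<ominus> y"] assms by simp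
qed

lemma vnorm_minus_triangle:
  assumes "x \<in> carrier V" "y \<in> carrier V" shows "\<parallel>x\<parallel> \<le> \<parallel>x \<ominus> y\<parallel> + \<parallel>y\<parallel>"
proof -
  have "(x \<ominus> y) \<oplus> y = x"
    using assms by (simp add: minus_eq a_assoc l_neg)
  then show ?thesis
    using vnorm_triangle[of "x \<ominus> y" y] assms by simp
qed

lemma minus_cancel [simp]:
  assumes "x \<in> carrier V" "y \<in> carrier V" shows "(x \<oplus> y) \<ominus> y = x"
  using assms by (simp add: minus_eq a_assoc r_neg)

lemma minus_eq_zero_imp_eq:
  assumes "x \<in> carrier V" "y \<in> carrier V" "x \<ominus> y = \<zero>" shows "x = y"
proof -
  have "x = (x \<ominus> y) \<oplus> y"
    using assms(1,2) by (simp add: minus_eq a_assoc l_neg)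
  then show ?thesis
    using assms by simp
qed

end

section \<open>Extreme linear functionals below a sublinear functional\<close>

context normed_space
begin

text \<open>
  Over either field, real scalars suffice for the extension and extremality arguments; complex
  functionals enter only when their real parts are turned back into functionals.
\<close>

definition sublinear :: "('a \<Rightarrow> real) \<Rightarrow> bool" where
  "sublinear q \<longleftrightarrow> (\<forall>u\<in>carrier V. \<forall>v\<in>carrier V. q (u \<oplus> v) \<le> q u + q v) \<and>
     (\<forall>r\<ge>0. \<forall>v\<in>carrier V. q (complex_of_real r \<odot> v) = r * q v)"

definition real_linear :: "('a \<Rightarrow> real) \<Rightarrow> bool" where
  "real_linear q \<longleftrightarrow> (\<forall>u\<in>carrier V. \<forall>v\<in>carrier V. q (u \<oplus> v) = q u + q v) \<and>
     (\<forall>r. \<forall>v\<in>carrier V. q (complex_of_real r \<odot> v) = r * q v)"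

definition dominated :: "('a \<Rightarrow> real) \<Rightarrow> ('a \<Rightarrow> real) \<Rightarrow> bool" where
  "dominated q p \<longleftrightarrow> (\<forall>v\<in>carrier V. q v \<le> p v)"

lemma sublinearD:
  assumes "sublinear q"
  shows "u \<in> carrier V \<Longrightarrow> v \<in> carrier V \<Longrightarrow> q (u \<oplus> v) \<le> q u + q v"
    and "0 \<le> r \<Longrightarrow> v \<in> carrier V \<Longrightarrow> q (complex_of_real r \<odot> v) = r * q v"
  using assms by (auto simp: sublinear_def)

lemma real_linearD:
  assumes "real_linear q"
  shows "u \<in> carrier V \<Longrightarrow> v \<in> carrier V \<Longrightarrow> q (u \<oplus> v) = q u + q v"
    and "v \<in> carrier V \<Longrightarrow> q (complex_of_real r \<odot> v) = r * q v"
  using assms by (auto simp: real_linear_def)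

text \<open>
  A one-sided inequality is enough for homogeneity: applied to \<open>1 / r\<close> it gives the other side.
\<close>

lemma sublinearI:
  assumes add: "\<And>u v. u \<in> carrier V \<Longrightarrow> v \<in> carrier V \<Longrightarrow> q (u \<oplus> v) \<le> q u + q v"
    and zero: "q \<zero> = 0"
    and hom: "\<And>r v. 0 < r \<Longrightarrow> v \<in> carrier V \<Longrightarrow> q (complex_of_real r \<odot> v) \<le> r * q v"
  shows "sublinear q"
  unfolding sublinear_def
proof (intro conjI ballI allI impI)
  fix r :: real and v assume r: "0 \<le> r" and v: "v \<in> carrier V"
  show "q (complex_of_real r \<odot> v) = r * q v"
  proof (cases "r = 0")
    case True
    then show ?thesis
      using v zero by (simp add: smult_simps)
  next
    case False
    then have r': "0 < r" using r by simp
    have "complex_of_real (inverse r) \<odot> (complex_of_real r \<odot> v) = v"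
      using v r' smult_simps(3)[of "complex_of_real (inverse r)" "complex_of_real r" v]
      by (simp add: smult_simps flip: of_real_mult of_real_inverse)
    then have "r * q v \<le> q (complex_of_real r \<odot> v)"
      using hom[of "inverse r" "complex_of_real r \<odot> v"] r' v by (simp add: field_simps)
    then show ?thesis
      using hom[OF r' v] by simp
  qed
qed (use add in auto)

lemma sublinear_zero: "sublinear q \<Longrightarrow> q \<zero> = 0"
  using sublinearD(2)[of q 0 \<zero>] by (simp add: smult_simps)

lemma real_linear_neg: "real_linear q \<Longrightarrow> v \<in> carrier V \<Longrightarrow> q (\<ominus> v) = - q v"
  using real_linearD(2)[of q v "-1"] by (simp add: neg_one_smult)

lemma sublinear_neg_bound:
  assumes "sublinear q" "v \<in> carrier V" shows "- q (\<ominus> v) \<le> q v"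
  using sublinearD(1)[OF assms(1), of v "\<ominus> v"] assms by (simp add: sublinear_zero r_neg)

lemma sublinear_odd_imp_real_linear:
  assumes q: "sublinear q" and odd: "\<And>v. v \<in> carrier V \<Longrightarrow> q (\<ominus> v) \<le> - q v"
  shows "real_linear q"
  unfolding real_linear_def
proof (intro conjI ballI allI)
  have neg: "q (\<ominus> v) = - q v" if "v \<in> carrier V" for v
    using odd[OF that] sublinear_neg_bound[OF q that] by simp
  fix u v assume uv: "u \<in> carrier V" "v \<in> carrier V"
  have "- q (u \<oplus> v) \<le> - q u + - q v"
    using sublinearD(1)[OF q, of "\<ominus> u" "\<ominus> v"] uv neg by (simp add: minus_add[symmetric])
  then show "q (u \<oplus> v) = q u + q v"
    using sublinearD(1)[OF q uv] by simp
next
  have neg: "q (\<ominus> v) = - q v" if "v \<in> carrier V" for v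
    using odd[OF that] sublinear_neg_bound[OF q that] by simp
  fix r v assume v: "v \<in> carrier V"
  show "q (complex_of_real r \<odot> v) = r * q v"
  proof (cases "0 \<le> r")
    case False
    have "complex_of_real (-r) \<odot> (\<ominus> v) = complex_of_real r \<odot> v"
      using v by (simp flip: neg_one_smult add: smult_simps(3))
    then show ?thesis
      using sublinearD(2)[OF q, of "-r" "\<ominus> v"] False v by (simp add: neg)
  qed (simp add: sublinearD(2)[OF q _ v])
qed

lemma sublinear_vnorm: "sublinear (vnorm V)"
  by (auto simp: sublinear_def vnorm_triangle vnorm_smult)

text \<open>
  Up to the reparametrisation \<open>t \<mapsto> 1 / t\<close> this is the one-sided directional derivative of \<open>q\<close> at \<open>v\<close> in
  the direction \<open>u\<close>.  As a sublinear functional of \<open>u\<close> it is the support function of the set of linear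
  \<open>\<phi> \<le> q\<close> that attain the maximal value \<open>\<phi> v = q v\<close>; see \<open>dominated_by_directional_iff\<close>.
\<close>

definition directional :: "('a \<Rightarrow> real) \<Rightarrow> 'a \<Rightarrow> 'a \<Rightarrow> real" where
  "directional q v u = (INF t\<in>{0..}. q (u \<oplus> complex_of_real t \<odot> v) - t * q v)"

text \<open>
  The set \<open>{\<phi> linear. \<phi> \<le> q}\<close> is a face of the convex set \<open>{\<phi> linear. \<phi> \<le> p}\<close>.  Faces are represented
  by sublinear functionals instead of sets, so that intersecting a chain of faces becomes taking an
  infimum of functions.
\<close>

definition face_like :: "('a \<Rightarrow> real) \<Rightarrow> ('a \<Rightarrow> real) \<Rightarrow> bool" where
  "face_like p q \<longleftrightarrow> sublinear q \<and> dominated q p \<and>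
     (\<forall>\<phi> \<psi> t. real_linear \<phi> \<and> real_linear \<psi> \<and> dominated \<phi> p \<and> dominated \<psi> p \<and> 0 < t \<and> t < 1 \<and>
        dominated (\<lambda>v. (1 - t) * \<phi> v + t * \<psi> v) q \<longrightarrow> dominated \<phi> q \<and> dominated \<psi> q)"

lemma face_likeD:
  assumes "face_like p q"
  shows "sublinear q" "dominated q p"
    and "real_linear \<phi> \<Longrightarrow> real_linear \<psi> \<Longrightarrow> dominated \<phi> p \<Longrightarrow> dominated \<psi> p \<Longrightarrow> 0 < t \<Longrightarrow> t < 1 \<Longrightarrow>
      dominated (\<lambda>v. (1 - t) * \<phi> v + t * \<psi> v) q \<Longrightarrow> dominated \<phi> q \<and> dominated \<psi> q"
  using assms unfolding face_like_def by blast+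

lemma dominatedD: "dominated q p \<Longrightarrow> v \<in> carrier V \<Longrightarrow> q v \<le> p v"
  by (simp add: dominated_def)

lemma directional_le:
  assumes q: "sublinear q" and v: "v \<in> carrier V" and u: "u \<in> carrier V" and t: "0 \<le> t"
  shows "directional q v u \<le> q (u \<oplus> complex_of_real t \<odot> v) - t * q v"
  unfolding directional_def
proof (rule cINF_lower)
  show "bdd_below ((\<lambda>t. q (u \<oplus> complex_of_real t \<odot> v) - t * q v) ` {0..})"
  proof (rule bdd_belowI2)
    fix s :: real assume "s \<in> {0..}"
    have "(u \<oplus> complex_of_real s \<odot> v) \<oplus> \<ominus> u = complex_of_real s \<odot> v"
      using u v by (metis a_comm minus_eq minus_cancel of_real_mem smult_simps(1))
    then have "s * q v \<le> q (u \<oplus> complex_of_real s \<odot> v) + q (\<ominus> u)"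
      using sublinearD(1)[OF q, of "u \<oplus> complex_of_real s \<odot> v" "\<ominus> u"] u v sublinearD(2)[OF q, of s v] \<open>s \<in> {0..}\<close>
      by simp
    then show "- q (\<ominus> u) \<le> q (u \<oplus> complex_of_real s \<odot> v) - s * q v"
      by simp
  qed
qed (use t in auto)

lemma le_directionalI:
  assumes "\<And>t. 0 \<le> t \<Longrightarrow> c \<le> q (u \<oplus> complex_of_real t \<odot> v) - t * q v"
  shows "c \<le> directional q v u"
  unfolding directional_def by (rule cINF_greatest) (use assms in auto)

lemma directional_dominated:
  assumes "sublinear q" "v \<in> carrier V" shows "dominated (directional q v) q"
proof (unfold dominated_def, intro ballI)
  fix u assume "u \<in> carrier V"
  then show "directional q v u \<le> q u"
    using directional_le[OF assms, of u 0] assms by (simp add: smult_simps)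
qed

lemma sublinear_directional:
  assumes q: "sublinear q" and v: "v \<in> carrier V"
  shows "sublinear (directional q v)"
proof (rule sublinearI)
  fix u w assume uw: "u \<in> carrier V" "w \<in> carrier V"
  have *: "directional q v (u \<oplus> w) \<le> (q (u \<oplus> complex_of_real s \<odot> v) - s * q v) + (q (w \<oplus> complex_of_real t \<odot> v) - t * q v)"
    if st: "0 \<le> s" "0 \<le> t" for s t
  proof -
    have "(u \<oplus> w) \<oplus> complex_of_real (s + t) \<odot> v = (u \<oplus> complex_of_real s \<odot> v) \<oplus> (w \<oplus> complex_of_real t \<odot> v)"
      using uw v by (simp add: smult_simps a_ac)
    then show ?thesis
      using directional_le[OF q v, of "u \<oplus> w" "s + t"] uw st v
        sublinearD(1)[OF q, of "u \<oplus> complex_of_real s \<odot> v" "w \<oplus> complex_of_real t \<odot> v"]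
      by (simp add: algebra_simps)
  qed
  have "directional q v (u \<oplus> w) - directional q v u \<le> directional q v w"
  proof (rule le_directionalI)
    fix t :: real assume t: "0 \<le> t"
    have "directional q v (u \<oplus> w) - (q (w \<oplus> complex_of_real t \<odot> v) - t * q v) \<le> directional q v u"
    proof (rule le_directionalI)
      fix s :: real assume "0 \<le> s"
      from *[OF this t]
      show "directional q v (u \<oplus> w) - (q (w \<oplus> complex_of_real t \<odot> v) - t * q v)
          \<le> q (u \<oplus> complex_of_real s \<odot> v) - s * q v" by simp
    qed
    then show "directional q v (u \<oplus> w) - directional q v u \<le> q (w \<oplus> complex_of_real t \<odot> v) - t * q v"
      by simp
  qed
  then show "directional q v (u \<oplus> w) \<le> directional q v u + directional q v w"
    by simp
next
  fix r :: real and u assume r: "0 < r" and u: "u \<in> carrier V"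
  show "directional q v (complex_of_real r \<odot> u) \<le> r * directional q v u"
  proof -
    have "directional q v (complex_of_real r \<odot> u) / r \<le> directional q v u"
    proof (rule le_directionalI)
      fix t :: real assume t: "0 \<le> t"
      have eq: "complex_of_real r \<odot> u \<oplus> complex_of_real (r * t) \<odot> v = complex_of_real r \<odot> (u \<oplus> complex_of_real t \<odot> v)"
        using u v by (simp add: smult_simps)
      have "q (complex_of_real r \<odot> (u \<oplus> complex_of_real t \<odot> v)) = r * q (u \<oplus> complex_of_real t \<odot> v)"
        using sublinearD(2)[OF q, of r "u \<oplus> complex_of_real t \<odot> v"] r u v by simp
      then have "directional q v (complex_of_real r \<odot> u) \<le> r * (q (u \<oplus> complex_of_real t \<odot> v) - t * q v)"
        using directional_le[OF q v, of "complex_of_real r \<odot> u" "r * t"] r t u v unfolding eq by (simp add: algebra_simps)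
      then show "directional q v (complex_of_real r \<odot> u) / r \<le> q (u \<oplus> complex_of_real t \<odot> v) - t * q v"
        using r by (simp add: divide_le_eq mult.commute)
    qed
    then show ?thesis
      using r by (simp add: divide_le_eq mult.commute)
  qed
next
  have "q (\<zero> \<oplus> complex_of_real t \<odot> v) - t * q v = 0" if "0 \<le> t" for t
    using sublinearD(2)[OF q that v] v by simp
  then have "(\<lambda>t. q (\<zero> \<oplus> complex_of_real t \<odot> v) - t * q v) ` {0..} = {0}"
    by (auto simp: image_def intro: bexI[of _ 0])
  then show "directional q v \<zero> = 0"
    unfolding directional_def by simp
qed

lemma directional_neg_le:
  assumes "sublinear q" "v \<in> carrier V" shows "directional q v (\<ominus> v) \<le> - q v"
  using directional_le[OF assms, of "\<ominus> v" 1] assms by (simp add: smult_simps l_neg sublinear_zero)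

lemma dominated_by_directional_iff:
  assumes q: "sublinear q" and v: "v \<in> carrier V" and \<phi>: "real_linear \<phi>"
  shows "dominated \<phi> (directional q v) \<longleftrightarrow> dominated \<phi> q \<and> q v \<le> \<phi> v"
proof
  assume L: "dominated \<phi> (directional q v)"
  have "dominated \<phi> q"
    using L directional_dominated[OF q v] by (force simp: dominated_def)
  moreover have "q v \<le> \<phi> v"
    using dominatedD[OF L, of "\<ominus> v"] directional_neg_le[OF q v] real_linear_neg[OF \<phi> v] v by simp
  ultimately show "dominated \<phi> q \<and> q v \<le> \<phi> v" ..
next
  assume R: "dominated \<phi> q \<and> q v \<le> \<phi> v"
  show "dominated \<phi> (directional q v)"
    unfolding dominated_def
  proof (intro ballI le_directionalI)
    fix u and t :: real assume u: "u \<in> carrier V" and t: "0 \<le> t"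
    have "\<phi> u + t * \<phi> v \<le> q (u \<oplus> complex_of_real t \<odot> v)"
      using R u v real_linearD[OF \<phi>] dominatedD[of \<phi> q "u \<oplus> complex_of_real t \<odot> v"] by simp
    moreover have "t * q v \<le> t * \<phi> v"
      using R t by (simp add: mult_left_mono)
    ultimately show "\<phi> u \<le> q (u \<oplus> complex_of_real t \<odot> v) - t * q v"
      by simp
  qed
qed

lemma real_linear_convex_combination:
  "real_linear \<phi> \<Longrightarrow> real_linear \<psi> \<Longrightarrow> real_linear (\<lambda>v. (1 - t) * \<phi> v + t * \<psi> v)"
  by (auto simp: real_linear_def algebra_simps)

text \<open>
  If a proper convex combination of \<open>\<phi>, \<psi> \<le> q\<close> is maximal at \<open>v\<close>, then both \<open>\<phi>\<close> and \<open>\<psi>\<close> are.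
\<close>

lemma face_like_directional:
  assumes f: "face_like p q" and v: "v \<in> carrier V"
  shows "face_like p (directional q v)"
  unfolding face_like_def
proof (intro conjI allI impI; (elim conjE)?)
  note q = face_likeD(1)[OF f]
  show "sublinear (directional q v)"
    by (rule sublinear_directional[OF q v])
  show "dominated (directional q v) p"
    using directional_dominated[OF q v] face_likeD(2)[OF f] by (force simp: dominated_def)
  fix \<phi> \<psi> :: "'a \<Rightarrow> real" and t :: real
  assume lin: "real_linear \<phi>" "real_linear \<psi>" and dom: "dominated \<phi> p" "dominated \<psi> p"
    and t: "0 < t" "t < 1" and conv: "dominated (\<lambda>v. (1 - t) * \<phi> v + t * \<psi> v) (directional q v)"
  have conv': "dominated (\<lambda>v. (1 - t) * \<phi> v + t * \<psi> v) q" "q v \<le> (1 - t) * \<phi> v + t * \<psi> v"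
    using conv dominated_by_directional_iff[OF q v real_linear_convex_combination[OF lin]] by auto
  have dq: "dominated \<phi> q" "dominated \<psi> q"
    using face_likeD(3)[OF f lin dom t conv'(1)] by auto
  have "\<phi> v \<le> q v" "\<psi> v \<le> q v"
    using dq v by (auto simp: dominated_def)
  then have "(1 - t) * \<phi> v \<le> (1 - t) * q v" "t * \<psi> v \<le> t * q v"
    using t by (auto intro: mult_left_mono)
  then have "(1 - t) * q v \<le> (1 - t) * \<phi> v" "t * q v \<le> t * \<psi> v"
    using conv'(2) by (auto simp: algebra_simps)
  then have "q v \<le> \<phi> v" "q v \<le> \<psi> v"
    using t by auto
  then show "dominated \<phi> (directional q v)" "dominated \<psi> (directional q v)"
    using dominated_by_directional_iff[OF q v] lin dq by auto
qed

lemma face_like_self: "sublinear p \<Longrightarrow> face_like p p"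
  by (auto simp: face_like_def dominated_def)

lemma face_like_cong:
  assumes "\<And>v. v \<in> carrier V \<Longrightarrow> q v = q' v" "face_like p q"
  shows "face_like p q'"
proof -
  have "sublinear q' = sublinear q"
    using assms(1) by (simp add: sublinear_def)
  moreover have "dominated q' p = dominated q p" "\<And>r. dominated r q' = dominated r q"
    using assms(1) by (simp_all add: dominated_def)
  ultimately have "face_like p q' = face_like p q"
    unfolding face_like_def by (simp only:)
  then show ?thesis
    using assms(2) by simp
qed

text \<open>
  The infimum is finite because \<open>q v \<ge> - p (\<ominus> v)\<close> for every \<open>q\<close> of the chain, and subadditive because two
  members of the chain can be replaced by the smaller one.
\<close>

lemma face_like_chain_INF:
  assumes C: "C \<noteq> {}" "\<And>q. q \<in> C \<Longrightarrow> face_like p q" and p: "sublinear p"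
    and chain: "\<And>q r. q \<in> C \<Longrightarrow> r \<in> C \<Longrightarrow> dominated q r \<or> dominated r q"
  shows "face_like p (\<lambda>v. INF q\<in>C. q v)"
    and "q \<in> C \<Longrightarrow> dominated (\<lambda>v. INF q\<in>C. q v) q"
proof -
  define m where "m = (\<lambda>v. INF q\<in>C. q v)"
  have bdd: "bdd_below ((\<lambda>q. q v) ` C)" if "v \<in> carrier V" for v
  proof (rule bdd_belowI2)
    fix q assume "q \<in> C"
    then show "- p (\<ominus> v) \<le> q v"
      using sublinear_neg_bound[OF face_likeD(1)[OF C(2)] that, of q] face_likeD(2)[OF C(2), of q] that
      by (smt (verit) a_inv_closed dominatedD that)
  qed
  have le: "m v \<le> q v" if "q \<in> C" "v \<in> carrier V" for q v
    unfolding m_def by (rule cINF_lower[OF bdd[OF that(2)] that(1)])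
  have ge: "c \<le> m v" if "\<And>q. q \<in> C \<Longrightarrow> c \<le> q v" for c v
    unfolding m_def by (rule cINF_greatest[OF C(1) that])
  show "dominated m q" if "q \<in> C" for q
    using le[OF that] by (simp add: dominated_def)
  have sub: "sublinear m"
  proof (rule sublinearI)
    fix u w assume uw: "u \<in> carrier V" "w \<in> carrier V"
    have *: "m (u \<oplus> w) \<le> q u + r w" if qr: "q \<in> C" "r \<in> C" for q r
    proof -
      obtain s where s: "s \<in> C" "dominated s q" "dominated s r"
        using chain[OF qr] qr by (auto simp: dominated_def)
      have "m (u \<oplus> w) \<le> s u + s w"
        using le[OF s(1), of "u \<oplus> w"] sublinearD(1)[OF face_likeD(1)[OF C(2)[OF s(1)]] uw] uw by simp
      also have "\<dots> \<le> q u + r w"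
        using s uw by (intro add_mono) (auto simp: dominated_def)
      finally show ?thesis .
    qed
    have "m (u \<oplus> w) - m u \<le> m w"
    proof (rule ge)
      fix r assume r: "r \<in> C"
      have "m (u \<oplus> w) - r w \<le> m u"
      proof (rule ge)
        fix q assume "q \<in> C"
        from *[OF this r] show "m (u \<oplus> w) - r w \<le> q u" by simp
      qed
      then show "m (u \<oplus> w) - m u \<le> r w" by simp
    qed
    then show "m (u \<oplus> w) \<le> m u + m w" by simp
  next
    have "(\<lambda>q. q \<zero>) ` C = (\<lambda>q. 0) ` C"
      using sublinear_zero[OF face_likeD(1)[OF C(2)]] by (intro image_cong) auto
    then show "m \<zero> = 0"
      using C(1) by (simp add: m_def)
  next
    fix r :: real and v assume r: "0 < r" and v: "v \<in> carrier V"
    have hom: "q (complex_of_real r \<odot> v) = r * q v" if "q \<in> C" for q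
      using sublinearD(2)[OF face_likeD(1)[OF C(2)[OF that]] _ v] r by simp
    have "m (complex_of_real r \<odot> v) / r \<le> m v"
      by (rule ge) (use le[of _ "complex_of_real r \<odot> v"] hom v r in \<open>simp add: divide_le_eq mult.commute\<close>)
    then show "m (complex_of_real r \<odot> v) \<le> r * m v"
      using r by (simp add: divide_le_eq mult.commute)
  qed
  obtain q0 where q0: "q0 \<in> C" using C(1) by auto
  have "dominated m p"
    using le[OF q0] face_likeD(2)[OF C(2)[OF q0]] by (force simp: dominated_def)
  moreover have "dominated \<phi> m \<and> dominated \<psi> m"
    if "real_linear \<phi>" "real_linear \<psi>" "dominated \<phi> p" "dominated \<psi> p" "0 < t" "t < 1"
      "dominated (\<lambda>v. (1 - t) * \<phi> v + t * \<psi> v) m" for \<phi> \<psi> t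
  proof -
    have "dominated \<phi> q \<and> dominated \<psi> q" if q: "q \<in> C" for q
    proof (rule face_likeD(3)[OF C(2)[OF q] \<open>real_linear \<phi>\<close> \<open>real_linear \<psi>\<close> \<open>dominated \<phi> p\<close> \<open>dominated \<psi> p\<close> \<open>0 < t\<close> \<open>t < 1\<close>])
      show "dominated (\<lambda>v. (1 - t) * \<phi> v + t * \<psi> v) q"
        using \<open>dominated (\<lambda>v. (1 - t) * \<phi> v + t * \<psi> v) m\<close> le[OF q] by (force simp: dominated_def)
    qed
    then show ?thesis
      by (auto simp: dominated_def intro: ge)
  qed
  ultimately show "face_like p m"
    using sub unfolding face_like_def by blast
qed

lemma real_linear_dominated_imp_eq:
  assumes "real_linear \<phi>" "real_linear q" "dominated \<phi> q" "v \<in> carrier V"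
  shows "\<phi> v = q v"
  using assms dominatedD[of \<phi> q v] dominatedD[of \<phi> q "\<ominus> v"] by (simp add: real_linear_neg)

text \<open>
  The Hahn--Banach and Krein--Milman theorems in one statement.  By Zorn's lemma there is a minimal
  sublinear functional \<open>q\<close> that represents a face.  Each \<open>directional q v\<close> also represents a face and lies
  below \<open>q\<close>, hence equals \<open>q\<close>; at \<open>\<ominus> v\<close> this gives \<open>q (\<ominus> v) \<le> - q v\<close>.  So \<open>q\<close> is linear, and the face it
  represents is the single point \<open>q\<close>.
\<close>

theorem extreme_dominated_functional:
  assumes p: "sublinear p" and v0: "v0 \<in> carrier V"
  obtains q where "real_linear q" "dominated q p" "q v0 = p v0"
    "\<And>\<phi> \<psi> t. real_linear \<phi> \<Longrightarrow> real_linear \<psi> \<Longrightarrow> dominated \<phi> p \<Longrightarrow> dominated \<psi> p \<Longrightarrow> 0 < t \<Longrightarrow> t < 1 \<Longrightarrow>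
      (\<And>v. v \<in> carrier V \<Longrightarrow> q v = (1 - t) * \<phi> v + t * \<psi> v) \<Longrightarrow>
      \<forall>v\<in>carrier V. \<phi> v = q v \<and> \<psi> v = q v"
proof -
  \<comment> \<open>The condition at \<open>\<ominus> v0\<close> encodes \<open>\<phi> v0 = p v0\<close> and, unlike that equation, passes to smaller \<open>q\<close>.\<close>
  define A where "A = {q \<in> extensional (carrier V). face_like p q \<and> q (\<ominus> v0) \<le> - p v0}"
  define P where "P = (\<lambda>q r. dominated r q)"
  have "\<exists>m\<in>A. \<forall>a\<in>A. P m a \<longrightarrow> a = m"
  proof (rule predicate_Zorn)
    show "partial_order_on A (relation_of P A)"
    proof (rule partial_order_on_relation_ofI)
      fix a b assume ab: "a \<in> A" "b \<in> A" "P a b" "P b a"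
      then have "a x = b x" if "x \<in> carrier V" for x
        using that by (simp add: P_def dominated_def antisym)
      moreover have "a \<in> extensional (carrier V)" "b \<in> extensional (carrier V)"
        using ab by (auto simp: A_def)
      ultimately show "a = b"
        using extensionalityI by blast
    next
      fix a b c assume "P a b" "P b c"
      then show "P a c"
        unfolding P_def dominated_def by (meson order_trans)
    qed (simp add: P_def dominated_def)
    fix C assume "C \<in> Chains (relation_of P A)"
    then have C: "C \<subseteq> A" "\<And>q r. q \<in> C \<Longrightarrow> r \<in> C \<Longrightarrow> dominated q r \<or> dominated r q"
      unfolding Chains_def relation_of_def P_def by blast+
    show "\<exists>u\<in>A. \<forall>a\<in>C. P a u"
    proof (cases "C = {}")
      case True
      \<comment> \<open>The empty chain shows that \<open>A\<close> is inhabited: the face of all \<open>\<phi>\<close> with \<open>\<phi> v0 = p v0\<close>.\<close>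
      have "restrict (directional p v0) (carrier V) \<in> A"
        using face_like_cong[OF _ face_like_directional[OF face_like_self[OF p] v0], of "restrict (directional p v0) (carrier V)"]
          directional_neg_le[OF p v0] v0
        by (simp add: A_def)
      then show ?thesis using True by auto
    next
      case False
      have fl: "\<And>q. q \<in> C \<Longrightarrow> face_like p q" using C(1) by (auto simp: A_def)
      define m where "m = restrict (\<lambda>v. INF q\<in>C. q v) (carrier V)"
      have m: "face_like p m"
        by (rule face_like_cong[OF _ face_like_chain_INF(1)[OF False fl p C(2)]]) (simp_all add: m_def)
      have dom: "dominated m q" if "q \<in> C" for q
        using face_like_chain_INF(2)[OF False fl p C(2) that] by (simp add: m_def dominated_def)
      obtain q0 where "q0 \<in> C" using False by auto
      then have "m (\<ominus> v0) \<le> q0 (\<ominus> v0)" "q0 (\<ominus> v0) \<le> - p v0"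
        using dominatedD[OF dom[of q0]] C(1) v0 by (auto simp: A_def)
      then have "m (\<ominus> v0) \<le> - p v0" by simp
      then have "m \<in> A"
        using m by (simp add: A_def m_def)
      then show ?thesis
        using dom unfolding P_def by blast
    qed
  qed
  then obtain q where q: "q \<in> A" and min: "\<And>a. a \<in> A \<Longrightarrow> dominated a q \<Longrightarrow> a = q"
    by (auto simp: P_def)
  have face: "face_like p q" and q0: "q (\<ominus> v0) \<le> - p v0"
    using q by (auto simp: A_def)
  note sub = face_likeD(1)[OF face]
  have lin: "real_linear q"
  proof (rule sublinear_odd_imp_real_linear[OF sub])
    fix v assume v: "v \<in> carrier V"
    define r where "r = restrict (directional q v) (carrier V)"
    have dom: "dominated r q"
      using directional_dominated[OF sub v] by (simp add: r_def dominated_def)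
    have "face_like p r"
      by (rule face_like_cong[OF _ face_like_directional[OF face v]]) (simp add: r_def)
    moreover have "r (\<ominus> v0) \<le> - p v0"
      using dominatedD[OF dom, of "\<ominus> v0"] q0 v0 by simp
    moreover have "r \<in> extensional (carrier V)"
      by (simp add: r_def)
    ultimately have "r \<in> A"
      unfolding A_def by blast
    then have "r = q"
      using dom by (rule min)
    then have "q (\<ominus> v) = restrict (directional q v) (carrier V) (\<ominus> v)"
      unfolding r_def by (rule arg_cong[OF sym])
    then have "q (\<ominus> v) = directional q v (\<ominus> v)"
      using v by (simp only: restrict_apply' a_inv_closed)
    then show "q (\<ominus> v) \<le> - q v"
      using directional_neg_le[OF sub v] by simp
  qed
  show ?thesis
  proof (rule that[OF lin face_likeD(2)[OF face]])
    show "q v0 = p v0"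
      using q0 real_linear_neg[OF lin v0] dominatedD[OF face_likeD(2)[OF face] v0] by simp
    fix \<phi> \<psi> :: "'a \<Rightarrow> real" and t :: real
    assume *: "real_linear \<phi>" "real_linear \<psi>" "dominated \<phi> p" "dominated \<psi> p" "0 < t" "t < 1"
      and eq: "\<And>v. v \<in> carrier V \<Longrightarrow> q v = (1 - t) * \<phi> v + t * \<psi> v"
    have "dominated (\<lambda>v. (1 - t) * \<phi> v + t * \<psi> v) q"
      by (simp add: dominated_def eq)
    from face_likeD(3)[OF face * this]
    show "\<forall>v\<in>carrier V. \<phi> v = q v \<and> \<psi> v = q v"
      using real_linear_dominated_imp_eq[OF *(1) lin] real_linear_dominated_imp_eq[OF *(2) lin] by blast
  qed
qed

end

section \<open>Bounded operators and the dual space\<close>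

lemma linear_opsD:
  assumes "T \<in> linear_ops F V W"
  shows "x \<in> carrier V \<Longrightarrow> T x \<in> carrier W"
    and "x \<in> carrier V \<Longrightarrow> y \<in> carrier V \<Longrightarrow> T (x \<oplus>\<^bsub>V\<^esub> y) = T x \<oplus>\<^bsub>W\<^esub> T y"
    and "c \<in> F \<Longrightarrow> x \<in> carrier V \<Longrightarrow> T (c \<odot>\<^bsub>V\<^esub> x) = c \<odot>\<^bsub>W\<^esub> T x"
    and "T \<in> extensional (carrier V)"
  using assms by (auto simp: linear_ops_def PiE_def)

locale normed_space_pair = V: normed_space F V + W: normed_space F W
  for F :: "complex set" and V :: "'a normed_module" and W :: "'b normed_module"
begin

lemma linear_ops_zero: "T \<in> linear_ops F V W \<Longrightarrow> T \<zero>\<^bsub>V\<^esub> = \<zero>\<^bsub>W\<^esub>"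
  using linear_opsD(3)[of T F V W 0 "\<zero>\<^bsub>V\<^esub>"] linear_opsD(1)[of T F V W "\<zero>\<^bsub>V\<^esub>"]
  by (simp add: V.smult_simps W.smult_simps)

lemma linear_ops_minus:
  assumes "T \<in> linear_ops F V W" "x \<in> carrier V" "y \<in> carrier V"
  shows "T (x \<ominus>\<^bsub>V\<^esub> y) = T x \<ominus>\<^bsub>W\<^esub> T y"
  using assms by (simp add: V.minus_as_smult W.minus_as_smult linear_opsD[OF assms(1)])

lemma bounded_opsD:
  assumes "T \<in> bounded_ops F V W"
  shows "T \<in> linear_ops F V W" "\<exists>B\<ge>0. \<forall>x\<in>carrier V. \<parallel>T x\<parallel>\<^bsub>W\<^esub> \<le> B * \<parallel>x\<parallel>\<^bsub>V\<^esub>"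
proof -
  show "T \<in> linear_ops F V W" using assms by (simp add: bounded_ops_def)
  obtain B where B: "\<forall>x\<in>carrier V. \<parallel>T x\<parallel>\<^bsub>W\<^esub> \<le> B * \<parallel>x\<parallel>\<^bsub>V\<^esub>"
    using assms by (auto simp: bounded_ops_def)
  have "\<parallel>T x\<parallel>\<^bsub>W\<^esub> \<le> \<bar>B\<bar> * \<parallel>x\<parallel>\<^bsub>V\<^esub>" if "x \<in> carrier V" for x
    using order_trans[OF bspec[OF B that] mult_right_mono[of B "\<bar>B\<bar>"]] that by simp
  then show "\<exists>B\<ge>0. \<forall>x\<in>carrier V. \<parallel>T x\<parallel>\<^bsub>W\<^esub> \<le> B * \<parallel>x\<parallel>\<^bsub>V\<^esub>"
    by (intro exI[of _ "\<bar>B\<bar>"]) simp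
qed

lemma unit_ball_bound:
  assumes L: "T \<in> linear_ops F V W" and ball: "\<And>x. x \<in> unit_ball V \<Longrightarrow> \<parallel>T x\<parallel>\<^bsub>W\<^esub> \<le> B"
    and x: "x \<in> carrier V"
  shows "\<parallel>T x\<parallel>\<^bsub>W\<^esub> \<le> B * \<parallel>x\<parallel>\<^bsub>V\<^esub>"
proof (cases "\<parallel>x\<parallel>\<^bsub>V\<^esub> = 0")
  case True
  then have "x = \<zero>\<^bsub>V\<^esub>"
    using V.vnorm_eq_zeroD x by blast
  then show ?thesis
    using linear_ops_zero[OF L] by simp
next
  case False
  define c where "c = complex_of_real (inverse \<parallel>x\<parallel>\<^bsub>V\<^esub>)"
  have pos: "0 < \<parallel>x\<parallel>\<^bsub>V\<^esub>" using False V.vnorm_nonneg[OF x] by linarith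
  have "c \<in> F"
    unfolding c_def by (rule V.of_real_mem)
  moreover have "cmod c = inverse \<parallel>x\<parallel>\<^bsub>V\<^esub>"
    using pos by (simp add: c_def norm_inverse)
  ultimately have c: "c \<in> F" "cmod c = inverse \<parallel>x\<parallel>\<^bsub>V\<^esub>" .
  have "c \<odot>\<^bsub>V\<^esub> x \<in> unit_ball V"
    using x c pos by (simp add: unit_ball_def V.vnorm_smult)
  from ball[OF this] have "inverse \<parallel>x\<parallel>\<^bsub>V\<^esub> * \<parallel>T x\<parallel>\<^bsub>W\<^esub> \<le> B"
    using c x linear_opsD(1)[OF L x] by (simp add: linear_opsD(3)[OF L] W.vnorm_smult)
  then show ?thesis
    using pos by (simp add: field_simps)
qed

lemma zero_in_unit_ball: "\<zero>\<^bsub>V\<^esub> \<in> unit_ball V"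
  by (simp add: unit_ball_def)

lemma op_norm_leI:
  assumes "\<And>x. x \<in> carrier V \<Longrightarrow> \<parallel>x\<parallel>\<^bsub>V\<^esub> \<le> 1 \<Longrightarrow> \<parallel>T x\<parallel>\<^bsub>W\<^esub> \<le> c"
  shows "op_norm V W T \<le> c"
  unfolding op_norm_def
  by (rule cSUP_least) (use zero_in_unit_ball assms in \<open>auto simp: unit_ball_def\<close>)

lemma le_op_norm:
  assumes "T \<in> bounded_ops F V W" "x \<in> unit_ball V"
  shows "\<parallel>T x\<parallel>\<^bsub>W\<^esub> \<le> op_norm V W T"
  unfolding op_norm_def
proof (rule cSUP_upper[OF assms(2)])
  obtain B where B: "B \<ge> 0" "\<forall>x\<in>carrier V. \<parallel>T x\<parallel>\<^bsub>W\<^esub> \<le> B * \<parallel>x\<parallel>\<^bsub>V\<^esub>"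
    using bounded_opsD(2)[OF assms(1)] by blast
  show "bdd_above ((\<lambda>x. \<parallel>T x\<parallel>\<^bsub>W\<^esub>) ` unit_ball V)"
  proof (rule bdd_aboveI2)
    fix x assume "x \<in> unit_ball V"
    then have "\<parallel>T x\<parallel>\<^bsub>W\<^esub> \<le> B * \<parallel>x\<parallel>\<^bsub>V\<^esub>" "B * \<parallel>x\<parallel>\<^bsub>V\<^esub> \<le> B * 1"
      using B by (auto simp: unit_ball_def mult_left_le)
    then show "\<parallel>T x\<parallel>\<^bsub>W\<^esub> \<le> B" by simp
  qed
qed

lemma op_norm_nonneg:
  assumes "T \<in> bounded_ops F V W" shows "0 \<le> op_norm V W T"
  using le_op_norm[OF assms zero_in_unit_ball] linear_ops_zero[OF bounded_opsD(1)[OF assms]] by simp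

lemma op_norm_bound:
  assumes T: "T \<in> bounded_ops F V W" and x: "x \<in> carrier V"
  shows "\<parallel>T x\<parallel>\<^bsub>W\<^esub> \<le> op_norm V W T * \<parallel>x\<parallel>\<^bsub>V\<^esub>"
  by (rule unit_ball_bound[OF bounded_opsD(1)[OF T] le_op_norm[OF T] x])

text \<open>
  Names for the operations of \<^const>\<open>op_space\<close>: they do not depend on the set of operators that serves
  as the carrier, so closure properties can be stated before a particular space is chosen.
\<close>

definition zero_op :: "'a \<Rightarrow> 'b" where "zero_op = (\<lambda>x\<in>carrier V. \<zero>\<^bsub>W\<^esub>)"
definition add_op :: "('a \<Rightarrow> 'b) \<Rightarrow> ('a \<Rightarrow> 'b) \<Rightarrow> 'a \<Rightarrow> 'b" where
  "add_op S T = (\<lambda>x\<in>carrier V. S x \<oplus>\<^bsub>W\<^esub> T x)"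
definition smult_op :: "complex \<Rightarrow> ('a \<Rightarrow> 'b) \<Rightarrow> 'a \<Rightarrow> 'b" where
  "smult_op c T = (\<lambda>x\<in>carrier V. c \<odot>\<^bsub>W\<^esub> T x)"

lemma op_space_simps:
  "carrier (op_space V W A) = A" "\<zero>\<^bsub>op_space V W A\<^esub> = zero_op"
  "S \<oplus>\<^bsub>op_space V W A\<^esub> T = add_op S T" "c \<odot>\<^bsub>op_space V W A\<^esub> T = smult_op c T"
  "\<parallel>T\<parallel>\<^bsub>op_space V W A\<^esub> = op_norm V W T"
  by (simp_all add: op_space_def zero_op_def add_op_def smult_op_def)

lemma op_apply:
  "x \<in> carrier V \<Longrightarrow> zero_op x = \<zero>\<^bsub>W\<^esub>"
  "x \<in> carrier V \<Longrightarrow> add_op S T x = S x \<oplus>\<^bsub>W\<^esub> T x"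
  "x \<in> carrier V \<Longrightarrow> smult_op c T x = c \<odot>\<^bsub>W\<^esub> T x"
  by (simp_all add: zero_op_def add_op_def smult_op_def)

lemma linear_opsI:
  assumes "\<And>x. x \<in> carrier V \<Longrightarrow> T x \<in> carrier W" "T \<in> extensional (carrier V)"
    "\<And>x y. x \<in> carrier V \<Longrightarrow> y \<in> carrier V \<Longrightarrow> T (x \<oplus>\<^bsub>V\<^esub> y) = T x \<oplus>\<^bsub>W\<^esub> T y"
    "\<And>c x. c \<in> F \<Longrightarrow> x \<in> carrier V \<Longrightarrow> T (c \<odot>\<^bsub>V\<^esub> x) = c \<odot>\<^bsub>W\<^esub> T x"
  shows "T \<in> linear_ops F V W"
  using assms by (auto simp: linear_ops_def PiE_def)

lemma linear_ops_closed:
  "zero_op \<in> linear_ops F V W"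
  "S \<in> linear_ops F V W \<Longrightarrow> T \<in> linear_ops F V W \<Longrightarrow> add_op S T \<in> linear_ops F V W"
  "c \<in> F \<Longrightarrow> T \<in> linear_ops F V W \<Longrightarrow> smult_op c T \<in> linear_ops F V W"
proof -
  show "zero_op \<in> linear_ops F V W"
    by (rule linear_opsI) (auto simp: op_apply W.smult_simps zero_op_def)
  show "add_op S T \<in> linear_ops F V W" if ST: "S \<in> linear_ops F V W" "T \<in> linear_ops F V W"
  proof (rule linear_opsI)
    show "add_op S T \<in> extensional (carrier V)" by (simp add: add_op_def)
  qed (use linear_opsD(1)[OF ST(1)] linear_opsD(1)[OF ST(2)] in
       \<open>auto simp: op_apply linear_opsD[OF ST(1)] linear_opsD[OF ST(2)] W.smult_simps W.a_ac\<close>)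
  show "smult_op c T \<in> linear_ops F V W" if cT: "c \<in> F" "T \<in> linear_ops F V W"
  proof (rule linear_opsI)
    show "smult_op c T \<in> extensional (carrier V)" by (simp add: smult_op_def)
  qed (use cT(1) linear_opsD(1)[OF cT(2)] in
       \<open>auto simp: op_apply linear_opsD[OF cT(2)] W.smult_simps mult.commute\<close>)
qed

lemma bounded_opsI:
  assumes "T \<in> linear_ops F V W" "\<And>x. x \<in> carrier V \<Longrightarrow> \<parallel>T x\<parallel>\<^bsub>W\<^esub> \<le> B * \<parallel>x\<parallel>\<^bsub>V\<^esub>"
  shows "T \<in> bounded_ops F V W"
  using assms by (auto simp: bounded_ops_def)

lemma bounded_ops_closed:
  "zero_op \<in> bounded_ops F V W"
  "S \<in> bounded_ops F V W \<Longrightarrow> T \<in> bounded_ops F V W \<Longrightarrow> add_op S T \<in> bounded_ops F V W"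
  "c \<in> F \<Longrightarrow> T \<in> bounded_ops F V W \<Longrightarrow> smult_op c T \<in> bounded_ops F V W"
proof -
  show "zero_op \<in> bounded_ops F V W"
    by (rule bounded_opsI[OF linear_ops_closed(1), of 0]) (simp add: op_apply)
  show "add_op S T \<in> bounded_ops F V W" if ST: "S \<in> bounded_ops F V W" "T \<in> bounded_ops F V W"
  proof (rule bounded_opsI)
    fix x assume x: "x \<in> carrier V"
    have "\<parallel>add_op S T x\<parallel>\<^bsub>W\<^esub> \<le> \<parallel>S x\<parallel>\<^bsub>W\<^esub> + \<parallel>T x\<parallel>\<^bsub>W\<^esub>"
      using x ST by (simp add: op_apply W.vnorm_triangle linear_opsD(1)[OF bounded_opsD(1)])
    also have "\<dots> \<le> op_norm V W S * \<parallel>x\<parallel>\<^bsub>V\<^esub> + op_norm V W T * \<parallel>x\<parallel>\<^bsub>V\<^esub>"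
      by (intro add_mono op_norm_bound ST x)
    finally show "\<parallel>add_op S T x\<parallel>\<^bsub>W\<^esub> \<le> (op_norm V W S + op_norm V W T) * \<parallel>x\<parallel>\<^bsub>V\<^esub>"
      by (simp add: algebra_simps)
  qed (intro linear_ops_closed bounded_opsD ST)
  show "smult_op c T \<in> bounded_ops F V W" if cT: "c \<in> F" "T \<in> bounded_ops F V W"
  proof (rule bounded_opsI)
    fix x assume x: "x \<in> carrier V"
    show "\<parallel>smult_op c T x\<parallel>\<^bsub>W\<^esub> \<le> (cmod c * op_norm V W T) * \<parallel>x\<parallel>\<^bsub>V\<^esub>"
      using x cT op_norm_bound[OF cT(2) x] linear_opsD(1)[OF bounded_opsD(1)[OF cT(2)] x]
      by (simp add: op_apply W.vnorm_smult mult.assoc mult_left_mono)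
  qed (intro linear_ops_closed bounded_opsD cT)
qed

lemma op_norm_smult:
  assumes c: "c \<in> F" and T: "T \<in> bounded_ops F V W"
  shows "op_norm V W (smult_op c T) = cmod c * op_norm V W T"
proof (rule antisym)
  note cl = linear_opsD(1)[OF bounded_opsD(1)[OF T]]
  have eq: "\<parallel>smult_op c T x\<parallel>\<^bsub>W\<^esub> = cmod c * \<parallel>T x\<parallel>\<^bsub>W\<^esub>" if "x \<in> carrier V" for x
    using that c cl by (simp add: op_apply W.vnorm_smult)
  show "op_norm V W (smult_op c T) \<le> cmod c * op_norm V W T"
    by (rule op_norm_leI) (auto simp: eq unit_ball_def intro!: mult_left_mono le_op_norm[OF T])
  show "cmod c * op_norm V W T \<le> op_norm V W (smult_op c T)"
  proof (cases "c = 0")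
    case True
    then show ?thesis
      using op_norm_nonneg[OF bounded_ops_closed(3)[OF c T]] by simp
  next
    case False
    have "op_norm V W T \<le> op_norm V W (smult_op c T) / cmod c"
    proof (rule op_norm_leI)
      fix x assume "x \<in> carrier V" "\<parallel>x\<parallel>\<^bsub>V\<^esub> \<le> 1"
      then show "\<parallel>T x\<parallel>\<^bsub>W\<^esub> \<le> op_norm V W (smult_op c T) / cmod c"
        using le_op_norm[OF bounded_ops_closed(3)[OF c T], of x] eq[of x] False
        by (simp add: unit_ball_def field_simps)
    qed
    then show ?thesis
      using False by (simp add: field_simps)
  qed
qed

lemma normed_op_space:
  assumes A: "A \<subseteq> bounded_ops F V W" and zero: "zero_op \<in> A"
    and add: "\<And>S T. S \<in> A \<Longrightarrow> T \<in> A \<Longrightarrow> add_op S T \<in> A"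
    and smult: "\<And>c T. c \<in> F \<Longrightarrow> T \<in> A \<Longrightarrow> smult_op c T \<in> A"
  shows "normed_space F (op_space V W A)"
proof -
  have cl: "T x \<in> carrier W" if "T \<in> A" "x \<in> carrier V" for T x
    using that A linear_opsD(1)[OF bounded_opsD(1)] by blast
  have ext: "T \<in> extensional (carrier V)" if "T \<in> A" for T
    using that A linear_opsD(4)[OF bounded_opsD(1)] by blast
  have eqI: "S = T" if "S \<in> extensional (carrier V)" "T \<in> extensional (carrier V)"
    "\<And>x. x \<in> carrier V \<Longrightarrow> S x = T x" for S T :: "'a \<Rightarrow> 'b"
    using extensionalityI[OF that] .
  have exts [simp]: "zero_op \<in> extensional (carrier V)" "add_op S T \<in> extensional (carrier V)"
    "smult_op c T \<in> extensional (carrier V)" for S T c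
    by (simp_all add: zero_op_def add_op_def smult_op_def)
  show ?thesis
  proof (rule normed_spaceI, unfold op_space_simps)
    show "F = \<real> \<or> F = UNIV" by (rule V.scalar_field)
    show "T = zero_op" if T: "T \<in> A" and z: "op_norm V W T = 0" for T
    proof (rule eqI)
      fix x assume x: "x \<in> carrier V"
      have "\<parallel>T x\<parallel>\<^bsub>W\<^esub> = 0"
        using op_norm_bound[OF subsetD[OF A T] x] z cl[OF T x] W.vnorm_nonneg[OF cl[OF T x]] by simp
      then show "T x = zero_op x"
        using cl[OF T x] x W.vnorm_eq_zeroD by (simp add: op_apply)
    qed (use ext[OF T] in auto)
    show "op_norm V W (smult_op c T) = cmod c * op_norm V W T" if "c \<in> F" "T \<in> A" for c T
      using that A op_norm_smult by blast
    show "op_norm V W (add_op S T) \<le> op_norm V W S + op_norm V W T" if "S \<in> A" "T \<in> A" for S T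
    proof (rule op_norm_leI)
      fix x assume x: "x \<in> carrier V" "\<parallel>x\<parallel>\<^bsub>V\<^esub> \<le> 1"
      have "\<parallel>add_op S T x\<parallel>\<^bsub>W\<^esub> \<le> \<parallel>S x\<parallel>\<^bsub>W\<^esub> + \<parallel>T x\<parallel>\<^bsub>W\<^esub>"
        using x that cl by (simp add: op_apply W.vnorm_triangle)
      also have "\<dots> \<le> op_norm V W S + op_norm V W T"
        using that A x by (intro add_mono le_op_norm) (auto simp: unit_ball_def)
      finally show "\<parallel>add_op S T x\<parallel>\<^bsub>W\<^esub> \<le> op_norm V W S + op_norm V W T" .
    qed
  next
    fix R S T assume RST: "R \<in> A" "S \<in> A" "T \<in> A"
    show "add_op (add_op R S) T = add_op R (add_op S T)"
      by (rule eqI) (simp_all add: op_apply cl RST W.a_assoc)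
  next
    fix S T assume ST: "S \<in> A" "T \<in> A"
    show "add_op S T = add_op T S"
      by (rule eqI) (simp_all add: op_apply cl ST W.a_comm)
    show "add_op zero_op T = T" "smult_op 0 T = zero_op" "smult_op 1 T = T"
      by (rule eqI; simp add: op_apply cl ext ST W.smult_simps)+
    fix a b assume ab: "a \<in> F" "b \<in> F"
    show "smult_op (a + b) T = add_op (smult_op a T) (smult_op b T)"
      "smult_op a (add_op S T) = add_op (smult_op a S) (smult_op a T)"
      "smult_op (a * b) T = smult_op a (smult_op b T)"
      by (rule eqI; simp add: op_apply cl ab ST W.smult_simps)+
  qed (use zero add smult in auto)
qed

end

lemma scalar_space_simps [simp]:
  "carrier (scalar_space F) = F" "\<zero>\<^bsub>scalar_space F\<^esub> = 0" "a \<oplus>\<^bsub>scalar_space F\<^esub> b = a + b"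
  "a \<odot>\<^bsub>scalar_space F\<^esub> b = a * b" "\<parallel>a\<parallel>\<^bsub>scalar_space F\<^esub> = cmod a"
  by (simp_all add: scalar_space_def)

lemma normed_scalar_space:
  assumes "F = \<real> \<or> F = UNIV" shows "normed_space F (scalar_space F)"
  by (rule normed_spaceI) (use assms in \<open>auto simp: algebra_simps norm_mult norm_triangle_ineq\<close>)

context normed_space
begin

lemma pair_scalar: "normed_space_pair F V (scalar_space F)"
  by (intro normed_space_pair.intro normed_space_axioms normed_scalar_space scalar_field)

lemma dual_simps:
  "carrier (dual F V) = bounded_ops F V (scalar_space F)"
  "\<parallel>f\<parallel>\<^bsub>dual F V\<^esub> = op_norm V (scalar_space F) f"
  "x \<in> carrier V \<Longrightarrow> (f \<oplus>\<^bsub>dual F V\<^esub> g) x = f x + g x"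
  "x \<in> carrier V \<Longrightarrow> (c \<odot>\<^bsub>dual F V\<^esub> f) x = c * f x"
  by (simp_all add: dual_def op_space_def)

lemma normed_dual: "normed_space F (dual F V)"
proof -
  interpret P: normed_space_pair F V "scalar_space F" by (rule pair_scalar)
  show ?thesis
    unfolding dual_def by (rule P.normed_op_space) (use P.bounded_ops_closed in auto)
qed

lemma dualD:
  assumes "f \<in> carrier (dual F V)"
  shows "x \<in> carrier V \<Longrightarrow> f x \<in> F"
    and "x \<in> carrier V \<Longrightarrow> y \<in> carrier V \<Longrightarrow> f (x \<oplus> y) = f x + f y"
    and "c \<in> F \<Longrightarrow> x \<in> carrier V \<Longrightarrow> f (c \<odot> x) = c * f x"
    and "x \<in> carrier V \<Longrightarrow> cmod (f x) \<le> \<parallel>f\<parallel>\<^bsub>dual F V\<^esub> * \<parallel>x\<parallel>"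
proof -
  interpret P: normed_space_pair F V "scalar_space F" by (rule pair_scalar)
  have f: "f \<in> bounded_ops F V (scalar_space F)" using assms by (simp add: dual_simps)
  show "x \<in> carrier V \<Longrightarrow> f x \<in> F"
    "x \<in> carrier V \<Longrightarrow> y \<in> carrier V \<Longrightarrow> f (x \<oplus> y) = f x + f y"
    "c \<in> F \<Longrightarrow> x \<in> carrier V \<Longrightarrow> f (c \<odot> x) = c * f x"
    using linear_opsD[OF P.bounded_opsD(1)[OF f]] by auto
  show "x \<in> carrier V \<Longrightarrow> cmod (f x) \<le> \<parallel>f\<parallel>\<^bsub>dual F V\<^esub> * \<parallel>x\<parallel>"
    using P.op_norm_bound[OF f] by (simp add: dual_simps)
qed

lemma dualI:
  assumes "\<And>x. x \<in> carrier V \<Longrightarrow> f x \<in> F" "f \<in> extensional (carrier V)"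
    "\<And>x y. x \<in> carrier V \<Longrightarrow> y \<in> carrier V \<Longrightarrow> f (x \<oplus> y) = f x + f y"
    "\<And>c x. c \<in> F \<Longrightarrow> x \<in> carrier V \<Longrightarrow> f (c \<odot> x) = c * f x"
    "\<And>x. x \<in> carrier V \<Longrightarrow> cmod (f x) \<le> B * \<parallel>x\<parallel>"
  shows "f \<in> carrier (dual F V)"
proof -
  interpret P: normed_space_pair F V "scalar_space F" by (rule pair_scalar)
  show ?thesis
    unfolding dual_simps by (intro P.bounded_opsI P.linear_opsI) (use assms in auto)
qed

lemma dual_norm_le:
  assumes "\<And>x. x \<in> carrier V \<Longrightarrow> \<parallel>x\<parallel> \<le> 1 \<Longrightarrow> cmod (f x) \<le> c"
  shows "\<parallel>f\<parallel>\<^bsub>dual F V\<^esub> \<le> c"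
proof -
  interpret P: normed_space_pair F V "scalar_space F" by (rule pair_scalar)
  show ?thesis
    unfolding dual_simps by (rule P.op_norm_leI) (use assms in auto)
qed

lemma dual_minus:
  assumes "f \<in> carrier (dual F V)" "x \<in> carrier V" "y \<in> carrier V"
  shows "f (x \<ominus> y) = f x - f y"
  using assms by (simp add: minus_as_smult dualD[OF assms(1)])

end

section \<open>Norming functionals and extreme norming points\<close>

lemma complex_of_norm_bound:
  assumes "Re z = r" "cmod z \<le> r" shows "z = complex_of_real r"
proof -
  have "(Re z)\<^sup>2 + (Im z)\<^sup>2 \<le> (Re z)\<^sup>2"
    using assms cmod_power2[of z] power_mono[of "cmod z" r 2] by simp
  then have "Im z = 0" by simp
  then show ?thesis
    using assms by (simp add: complex_eq_iff)
qed

context normed_space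
begin

text \<open>
  A complex functional is determined by its real part \<open>q\<close>, as \<open>v \<mapsto> q v - i q (i v)\<close>.  The norm bound
  survives because \<open>f v\<close> can be rotated to a nonnegative real by a scalar of modulus 1, which for real
  scalars is a sign.
\<close>

lemma functional_of_real_linear:
  assumes q: "real_linear q" and dom: "dominated q (vnorm V)"
  obtains f where "f \<in> carrier (dual F V)" "\<And>v. v \<in> carrier V \<Longrightarrow> Re (f v) = q v"
    "\<And>v. v \<in> carrier V \<Longrightarrow> cmod (f v) \<le> \<parallel>v\<parallel>"
proof -
  define f where "f = (\<lambda>v\<in>carrier V. if F = UNIV then Complex (q v) (- q (\<i> \<odot> v)) else complex_of_real (q v))"
  have Re: "Re (f v) = q v" if "v \<in> carrier V" for v
    using that by (simp add: f_def)
  have mem: "f v \<in> F" if "v \<in> carrier V" for v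
    using that scalar_field by (auto simp: f_def)
  have add: "f (u \<oplus> v) = f u + f v" if uv: "u \<in> carrier V" "v \<in> carrier V" for u v
    using uv by (auto simp: f_def complex_eq_iff real_linearD(1)[OF q] smult_simps)
  have hom: "f (c \<odot> v) = c * f v" if c: "c \<in> F" and v: "v \<in> carrier V" for c v
  proof (cases "F = UNIV")
    case True
    have "c \<odot> v = complex_of_real (Re c) \<odot> v \<oplus> complex_of_real (Im c) \<odot> (\<i> \<odot> v)"
      using v True smult_simps(2)[of "complex_of_real (Re c)" "complex_of_real (Im c) * \<i>" v]
      by (simp add: smult_simps(3) complex_eq[of c, symmetric] mult.commute[of _ \<i>])
    then have 1: "q (c \<odot> v) = Re c * q v + Im c * q (\<i> \<odot> v)"
      using v True by (simp add: real_linearD[OF q])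
    have "\<i> * c = complex_of_real (Re c) * \<i> + complex_of_real (- Im c)"
      by (simp add: complex_eq_iff)
    then have "\<i> \<odot> (c \<odot> v) = complex_of_real (Re c) \<odot> (\<i> \<odot> v) \<oplus> complex_of_real (- Im c) \<odot> v"
      using v True smult_simps(2)[of "complex_of_real (Re c) * \<i>" "complex_of_real (- Im c)" v]
      by (simp add: smult_simps(3))
    then have 2: "q (\<i> \<odot> (c \<odot> v)) = Re c * q (\<i> \<odot> v) - Im c * q v"
      using v True by (simp only: real_linearD[OF q] smult_simps(1) UNIV_I of_real_mem)
    show ?thesis
      using v True c 1 2 by (simp add: f_def complex_eq_iff)
  next
    case False
    then obtain r where "c = complex_of_real r"
      using scalar_field c by (auto elim: Reals_cases)
    then show ?thesis
      using v False by (simp add: f_def real_linearD(2)[OF q])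
  qed
  have bound: "cmod (f v) \<le> \<parallel>v\<parallel>" if v: "v \<in> carrier V" for v
  proof (cases "f v = 0")
    case False
    define c where "c = cnj (f v) / complex_of_real (cmod (f v))"
    have c: "c \<in> F"
      using scalar_field mem[OF v] by (auto simp: c_def Reals_cnj_iff)
    have 1: "cmod c = 1"
      using False by (simp add: c_def norm_divide)
    have "c * f v = complex_of_real (cmod (f v))"
      using False by (simp add: c_def complex_norm_square[symmetric] power2_eq_square mult.commute)
    then have "cmod (f v) = q (c \<odot> v)"
      using Re[of "c \<odot> v"] hom[OF c v] c v by simp
    also have "\<dots> \<le> \<parallel>v\<parallel>"
      using dominatedD[OF dom, of "c \<odot> v"] c v 1 by (simp add: vnorm_smult)
    finally show ?thesis .
  qed (use v in simp)
  have "f \<in> carrier (dual F V)"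
  proof (rule dualI[where B = 1])
    show "f \<in> extensional (carrier V)" by (simp add: f_def)
  qed (use mem add hom bound in auto)
  then show ?thesis
    using Re bound that by blast
qed

lemma norming_functional:
  assumes v0: "v0 \<in> carrier V"
  obtains f where "f \<in> carrier (dual F V)" "f v0 = complex_of_real \<parallel>v0\<parallel>"
    "\<And>v. v \<in> carrier V \<Longrightarrow> cmod (f v) \<le> \<parallel>v\<parallel>"
proof -
  obtain q where q: "real_linear q" "dominated q (vnorm V)" "q v0 = \<parallel>v0\<parallel>"
    by (rule extreme_dominated_functional[OF sublinear_vnorm v0]) blast
  obtain f where f: "f \<in> carrier (dual F V)" "\<And>v. v \<in> carrier V \<Longrightarrow> Re (f v) = q v"
    "\<And>v. v \<in> carrier V \<Longrightarrow> cmod (f v) \<le> \<parallel>v\<parallel>"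
    using functional_of_real_linear[OF q(1,2)] by metis
  have "f v0 = complex_of_real \<parallel>v0\<parallel>"
    using f(2,3)[OF v0] q(3) by (intro complex_of_norm_bound) simp_all
  then show ?thesis using f that by blast
qed

text \<open>
  The hypothesis says that \<open>\<zero>\<close> is a best approximation to \<open>v0\<close> in the subspace \<open>W\<close>.  The distance to \<open>W\<close>
  is a sublinear functional that lies below the norm, agrees with it at \<open>v0\<close> and vanishes on \<open>W\<close>, so a
  linear functional below it that attains it at \<open>v0\<close> has all the required properties.
\<close>

lemma best_approximation_functional:
  assumes v0: "v0 \<in> carrier V" and W: "W \<subseteq> carrier V" "W \<noteq> {}"
    "\<And>u w. u \<in> W \<Longrightarrow> w \<in> W \<Longrightarrow> u \<oplus> w \<in> W" "\<And>c w. c \<in> F \<Longrightarrow> w \<in> W \<Longrightarrow> c \<odot> w \<in> W"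
    and best: "\<And>w. w \<in> W \<Longrightarrow> \<parallel>v0\<parallel> \<le> \<parallel>v0 \<oplus> w\<parallel>"
  obtains f where "f \<in> carrier (dual F V)" "f v0 = complex_of_real \<parallel>v0\<parallel>"
    "\<And>v. v \<in> carrier V \<Longrightarrow> cmod (f v) \<le> \<parallel>v\<parallel>" "\<And>w. w \<in> W \<Longrightarrow> f w = 0"
proof -
  \<comment> \<open>The distance of \<open>v\<close> to \<open>W\<close>; the sign of \<open>w\<close> is immaterial as \<open>W = -W\<close>.\<close>
  define p where "p v = (INF w\<in>W. \<parallel>v \<oplus> w\<parallel>)" for v
  have WV: "w \<in> carrier V" if "w \<in> W" for w using W(1) that by blast
  obtain w0 where "w0 \<in> W" using W(2) by blast
  then have zero: "\<zero> \<in> W"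
    using W(4)[of 0 w0] WV by (simp add: smult_simps)
  have le: "p v \<le> \<parallel>v \<oplus> w\<parallel>" if "v \<in> carrier V" "w \<in> W" for v w
    unfolding p_def by (rule cINF_lower[OF bdd_belowI2[of _ 0] that(2)]) (use that WV in auto)
  have ge: "c \<le> p v" if "\<And>w. w \<in> W \<Longrightarrow> c \<le> \<parallel>v \<oplus> w\<parallel>" for c v
    unfolding p_def by (rule cINF_greatest[OF W(2) that])
  have sub: "sublinear p"
  proof (rule sublinearI)
    fix u v assume uv: "u \<in> carrier V" "v \<in> carrier V"
    have *: "p (u \<oplus> v) \<le> \<parallel>u \<oplus> w\<parallel> + \<parallel>v \<oplus> w'\<parallel>" if "w \<in> W" "w' \<in> W" for w w'
    proof -
      have "(u \<oplus> v) \<oplus> (w \<oplus> w') = (u \<oplus> w) \<oplus> (v \<oplus> w')"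
        using uv that WV by (simp add: a_ac)
      then show ?thesis
        using le[of "u \<oplus> v" "w \<oplus> w'"] vnorm_triangle[of "u \<oplus> w" "v \<oplus> w'"] uv that WV W(3) by fastforce
    qed
    have "p (u \<oplus> v) - p u \<le> p v"
    proof (rule ge)
      fix w' assume w': "w' \<in> W"
      have "p (u \<oplus> v) - \<parallel>v \<oplus> w'\<parallel> \<le> p u"
        by (rule ge) (use *[OF _ w'] in \<open>simp add: algebra_simps\<close>)
      then show "p (u \<oplus> v) - p u \<le> \<parallel>v \<oplus> w'\<parallel>" by simp
    qed
    then show "p (u \<oplus> v) \<le> p u + p v" by simp
  next
    show "p \<zero> = 0"
    proof (rule antisym)
      show "p \<zero> \<le> 0"
        using le[OF zero_closed zero] by simp
      show "0 \<le> p \<zero>"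
        by (rule ge) (simp add: WV)
    qed
  next
    fix r :: real and v assume r: "0 < r" and v: "v \<in> carrier V"
    have "p (complex_of_real r \<odot> v) / r \<le> p v"
    proof (rule ge)
      fix w assume w: "w \<in> W"
      have "complex_of_real r \<odot> v \<oplus> complex_of_real r \<odot> w = complex_of_real r \<odot> (v \<oplus> w)"
        using v w WV by (simp add: smult_simps)
      then show "p (complex_of_real r \<odot> v) / r \<le> \<parallel>v \<oplus> w\<parallel>"
        using le[of "complex_of_real r \<odot> v" "complex_of_real r \<odot> w"] W(4)[OF of_real_mem w] r v w WV
        by (simp add: vnorm_smult divide_le_eq mult.commute)
    qed
    then show "p (complex_of_real r \<odot> v) \<le> r * p v"
      using r by (simp add: divide_le_eq mult.commute)
  qed
  obtain q where q: "real_linear q" "dominated q p" "q v0 = p v0"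
    by (rule extreme_dominated_functional[OF sub v0]) blast
  have "p v0 = \<parallel>v0\<parallel>"
    using le[OF v0 zero] ge[of "\<parallel>v0\<parallel>" v0] best v0 by simp
  have p_le: "p v \<le> \<parallel>v\<parallel>" if "v \<in> carrier V" for v
    using le[OF that zero] that by simp
  have "dominated q (vnorm V)"
    using q(2) p_le by (meson dominated_def order_trans)
  from functional_of_real_linear[OF q(1) this]
  obtain f where f: "f \<in> carrier (dual F V)" "\<And>v. v \<in> carrier V \<Longrightarrow> Re (f v) = q v"
    "\<And>v. v \<in> carrier V \<Longrightarrow> cmod (f v) \<le> \<parallel>v\<parallel>"
    by metis
  have q_le: "q w \<le> 0" if "w \<in> W" for w
  proof -
    have "w \<oplus> (-1) \<odot> w = \<zero>"
      using WV[OF that] by (simp add: neg_one_smult r_neg)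
    then have "p w \<le> 0"
      using le[OF WV[OF that] W(4)[OF scalars(3) that]] by simp
    then show ?thesis
      using dominatedD[OF q(2) WV[OF that]] by simp
  qed
  \<comment> \<open>The real part of \<open>f\<close> is at most 0 on all scalar multiples of \<open>w\<close>; the multiple by \<open>cnj (f w)\<close> decides.\<close>
  have zero_on: "f w = 0" if w: "w \<in> W" for w
  proof -
    have c: "cnj (f w) \<in> F"
      using dualD(1)[OF f(1) WV[OF w]] by simp
    have "(cmod (f w))\<^sup>2 = Re (cnj (f w) * f w)"
      by (subst cmod_power2) (simp add: power2_eq_square)
    also have "\<dots> = q (cnj (f w) \<odot> w)"
      using f(2)[of "cnj (f w) \<odot> w"] dualD(3)[OF f(1) c WV[OF w]] WV[OF w] c by simp
    also have "\<dots> \<le> 0"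
      by (rule q_le[OF W(4)[OF c w]])
    finally show ?thesis by simp
  qed
  have "f v0 = complex_of_real \<parallel>v0\<parallel>"
    using f(2,3)[OF v0] q(3) \<open>p v0 = \<parallel>v0\<parallel>\<close> by (intro complex_of_norm_bound) simp_all
  then show ?thesis using f zero_on that by blast
qed

lemma support_functionalsI:
  assumes f: "f \<in> carrier (dual F V)" "\<And>v. v \<in> carrier V \<Longrightarrow> cmod (f v) \<le> \<parallel>v\<parallel>"
    and u: "u \<in> carrier V" "u \<noteq> \<zero>" "f u = complex_of_real \<parallel>u\<parallel>"
  shows "f \<in> support_functionals F V u"
proof -
  have "0 < \<parallel>u\<parallel>"
    using u vnorm_eq_zeroD vnorm_nonneg by (metis order_le_less)
  then have "1 \<le> \<parallel>f\<parallel>\<^bsub>dual F V\<^esub>"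
    using dualD(4)[OF f(1) u(1)] u(3) by simp
  moreover have "\<parallel>f\<parallel>\<^bsub>dual F V\<^esub> \<le> 1"
    by (rule dual_norm_le) (use f(2) in force)
  ultimately show ?thesis
    using f u by (simp add: support_functionals_def)
qed

text \<open>
  An extreme real functional below the dual norm
  that attains it at \<open>g\<close> is the real part of an element of the bidual, hence by reflexivity of the
  evaluation at some \<open>x\<close>.  Evaluations at points of the ball lie below the dual norm, so a
  decomposition of \<open>x\<close> inside the ball decomposes the extreme functional; both summands then coincide
  with it, and functionals separate points.
\<close>

lemma extreme_norming_point:
  assumes refl: "reflexive F V" and g: "g \<in> carrier (dual F V)"
  obtains x where "x \<in> ball_extreme_points V" "Re (g x) = \<parallel>g\<parallel>\<^bsub>dual F V\<^esub>"
proof -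
  interpret D: normed_space F "dual F V" by (rule normed_dual)
  obtain q where q: "D.real_linear q" "D.dominated q (vnorm (dual F V))" "q g = \<parallel>g\<parallel>\<^bsub>dual F V\<^esub>"
    and extreme: "\<And>\<phi> \<psi> t. D.real_linear \<phi> \<Longrightarrow> D.real_linear \<psi> \<Longrightarrow> D.dominated \<phi> (vnorm (dual F V)) \<Longrightarrow>
      D.dominated \<psi> (vnorm (dual F V)) \<Longrightarrow> 0 < t \<Longrightarrow> t < 1 \<Longrightarrow>
      (\<And>f. f \<in> carrier (dual F V) \<Longrightarrow> q f = (1 - t) * \<phi> f + t * \<psi> f) \<Longrightarrow>
      \<forall>f\<in>carrier (dual F V). \<phi> f = q f \<and> \<psi> f = q f"
    by (rule D.extreme_dominated_functional[OF D.sublinear_vnorm g]) blast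
  obtain \<Phi> where \<Phi>: "\<Phi> \<in> carrier (dual F (dual F V))"
    "\<And>f. f \<in> carrier (dual F V) \<Longrightarrow> Re (\<Phi> f) = q f"
    "\<And>f. f \<in> carrier (dual F V) \<Longrightarrow> cmod (\<Phi> f) \<le> \<parallel>f\<parallel>\<^bsub>dual F V\<^esub>"
    using D.functional_of_real_linear[OF q(1,2)] by metis
  obtain x where x: "x \<in> carrier V" "\<And>f. f \<in> carrier (dual F V) \<Longrightarrow> \<Phi> f = f x"
    using refl \<Phi>(1) unfolding reflexive_def by blast
  have qx: "q f = Re (f x)" if "f \<in> carrier (dual F V)" for f
    using \<Phi>(2)[OF that] x(2)[OF that] by simp
  have norm_le: "\<parallel>v\<parallel> \<le> 1" if v: "v \<in> carrier V"
    and b: "\<And>f. f \<in> carrier (dual F V) \<Longrightarrow> cmod (f v) \<le> \<parallel>f\<parallel>\<^bsub>dual F V\<^esub>" for v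
  proof -
    obtain f where f: "f \<in> carrier (dual F V)" "f v = complex_of_real \<parallel>v\<parallel>"
      "\<And>v. v \<in> carrier V \<Longrightarrow> cmod (f v) \<le> \<parallel>v\<parallel>"
      using norming_functional[OF v] by metis
    have "\<parallel>f\<parallel>\<^bsub>dual F V\<^esub> \<le> 1"
      by (rule dual_norm_le) (use f(3) in force)
    then show ?thesis
      using b[OF f(1)] f(2) v by simp
  qed
  have xb: "x \<in> unit_ball V"
    using norm_le[OF x(1)] \<Phi>(3) x by (simp add: unit_ball_def)
  have ev_lin: "D.real_linear (\<lambda>f. Re (f a))" if "a \<in> carrier V" for a
    using that by (simp add: D.real_linear_def dual_simps)
  have ev_dom: "D.dominated (\<lambda>f. Re (f a)) (vnorm (dual F V))" if a: "a \<in> unit_ball V" for a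
    unfolding D.dominated_def
  proof
    fix f assume f: "f \<in> carrier (dual F V)"
    have "Re (f a) \<le> cmod (f a)" by (rule complex_Re_le_cmod)
    also have "\<dots> \<le> \<parallel>f\<parallel>\<^bsub>dual F V\<^esub> * \<parallel>a\<parallel>"
      using dualD(4)[OF f] a by (simp add: unit_ball_def)
    also have "\<dots> \<le> \<parallel>f\<parallel>\<^bsub>dual F V\<^esub>"
      using a D.vnorm_nonneg[OF f] by (simp add: unit_ball_def mult_left_le)
    finally show "Re (f a) \<le> \<parallel>f\<parallel>\<^bsub>dual F V\<^esub>" .
  qed
  have "x \<in> ball_extreme_points V"
    unfolding ball_extreme_points_def
  proof (intro CollectI conjI ballI allI impI xb)
    fix a b and t :: real
    assume a: "a \<in> unit_ball V" and b: "b \<in> unit_ball V"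
      and t: "0 < t \<and> t < 1 \<and> x = complex_of_real (1 - t) \<odot> a \<oplus> complex_of_real t \<odot> b"
    have ab: "a \<in> carrier V" "b \<in> carrier V" using a b by (auto simp: unit_ball_def)
    have conv: "q f = (1 - t) * Re (f a) + t * Re (f b)" if f: "f \<in> carrier (dual F V)" for f
    proof -
      have "f x = complex_of_real (1 - t) * f a + complex_of_real t * f b"
        using t ab by (simp only: dualD(2,3)[OF f] smult_simps(1) of_real_mem)
      then show ?thesis
        using qx[OF f] by simp
    qed
    have "\<forall>f\<in>carrier (dual F V). Re (f a) = q f \<and> Re (f b) = q f"
      using extreme[OF ev_lin[OF ab(1)] ev_lin[OF ab(2)] ev_dom[OF a] ev_dom[OF b] _ _ conv] t by blast
    then have eq: "Re (f a) = Re (f b)" if "f \<in> carrier (dual F V)" for f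
      using that by simp
    obtain f where f: "f \<in> carrier (dual F V)" "f (a \<ominus> b) = complex_of_real \<parallel>a \<ominus> b\<parallel>"
      using norming_functional[of "a \<ominus> b"] ab by (metis minus_closed)
    have "\<parallel>a \<ominus> b\<parallel> = Re (f a - f b)"
      using f dual_minus[OF f(1) ab] by simp
    then have "\<parallel>a \<ominus> b\<parallel> = 0"
      using eq[OF f(1)] by simp
    then show "a = b"
      using vnorm_eq_zeroD[of "a \<ominus> b"] minus_eq_zero_imp_eq ab by blast
  qed
  then show ?thesis
    using that qx[OF g] q(3) by simp
qed

end

section \<open>Minkowski's inequality and finite direct sums\<close>

text \<open>
  Convexity of \<open>x powr p\<close> on the closed half-line.  At the end point it reduces to \<open>t powr p \<le> t\<close> for
  \<open>0 \<le> t \<le> 1\<close>.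
\<close>

lemma powr_convex_nonneg:
  fixes x y s p :: real
  assumes p: "1 \<le> p" and xy: "0 \<le> x" "0 \<le> y" and s: "0 \<le> s" "s \<le> 1"
  shows "(s * x + (1 - s) * y) powr p \<le> s * x powr p + (1 - s) * y powr p"
proof -
  have scale: "(t * z) powr p \<le> t * z powr p" if "0 \<le> t" "t \<le> 1" "0 \<le> z" for t z :: real
  proof -
    have "t powr p \<le> t powr 1"
      using that p by (intro powr_mono')
    then show ?thesis
      using that by (simp add: powr_mult mult_right_mono)
  qed
  show ?thesis
  proof (cases "x = 0 \<or> y = 0")
    case True
    then show ?thesis
      using scale[of s x] scale[of "1 - s" y] xy s p by auto
  next
    case False
    then show ?thesis
      using convex_onD[OF powr_convex[OF p], of "1 - s" x y] xy s by simp
  qed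
qed

text \<open>
  With \<open>A\<close> and \<open>B\<close> the two norms on the right, \<open>(a + b) / (A + B)\<close> is a convex combination of the unit
  vectors \<open>a / A\<close> and \<open>b / B\<close>, so convexity of \<open>x powr p\<close> bounds its \<open>p\<close>-th power sum by 1.
\<close>

lemma minkowski_inequality:
  fixes a b :: "'i \<Rightarrow> real"
  assumes p: "1 \<le> p" and fin: "finite I"
    and a: "\<And>k. k \<in> I \<Longrightarrow> 0 \<le> a k" and b: "\<And>k. k \<in> I \<Longrightarrow> 0 \<le> b k"
  shows "(\<Sum>k\<in>I. (a k + b k) powr p) powr (1 / p) \<le> (\<Sum>k\<in>I. a k powr p) powr (1 / p) + (\<Sum>k\<in>I. b k powr p) powr (1 / p)"
proof -
  define A where "A = (\<Sum>k\<in>I. a k powr p) powr (1 / p)"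
  define B where "B = (\<Sum>k\<in>I. b k powr p) powr (1 / p)"
  have Ap: "A powr p = (\<Sum>k\<in>I. a k powr p)" and Bp: "B powr p = (\<Sum>k\<in>I. b k powr p)"
    using p by (simp_all add: A_def B_def powr_powr sum_nonneg)
  have zero: "\<forall>k\<in>I. c k = 0" if "(\<Sum>k\<in>I. c k powr p) powr (1 / p) = 0" for c :: "'i \<Rightarrow> real"
    using that fin by (simp add: sum_nonneg_eq_0_iff)
  show ?thesis
  proof (cases "A = 0 \<or> B = 0")
    case True
    then show ?thesis
    proof
      assume "A = 0"
      with zero[of a] show ?thesis by (simp add: A_def)
    next
      assume "B = 0"
      with zero[of b] show ?thesis by (simp add: B_def)
    qed
  next
    case False
    then have pos: "0 < A" "0 < B"
      by (auto simp: A_def B_def)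
    define s where "s = A / (A + B)"
    have s: "0 \<le> s" "s \<le> 1" "1 - s = B / (A + B)"
      using pos by (auto simp: s_def field_simps)
    have summand: "((a k + b k) / (A + B)) powr p \<le> s * (a k powr p / A powr p) + (1 - s) * (b k powr p / B powr p)"
      if k: "k \<in> I" for k
    proof -
      have "(a k + b k) / (A + B) = s * (a k / A) + (1 - s) * (b k / B)"
        unfolding s(3) using pos by (simp add: s_def add_divide_distrib)
      then show ?thesis
        using powr_convex_nonneg[OF p, of "a k / A" "b k / B" s] a[OF k] b[OF k] s pos by (simp add: powr_divide)
    qed
    have "(\<Sum>k\<in>I. ((a k + b k) / (A + B)) powr p) \<le> (\<Sum>k\<in>I. s * (a k powr p / A powr p) + (1 - s) * (b k powr p / B powr p))"
      by (rule sum_mono[OF summand])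
    also have "\<dots> = s * ((\<Sum>k\<in>I. a k powr p) / A powr p) + (1 - s) * ((\<Sum>k\<in>I. b k powr p) / B powr p)"
      by (simp add: sum.distrib flip: sum_distrib_left sum_divide_distrib)
    also have "\<dots> = 1"
      using pos by (simp flip: Ap Bp)
    finally have "(\<Sum>k\<in>I. (a k + b k) powr p) / (A + B) powr p \<le> 1"
      using a b pos by (simp add: powr_divide flip: sum_divide_distrib)
    then have "(\<Sum>k\<in>I. (a k + b k) powr p) \<le> (A + B) powr p"
      using pos by simp
    then have "(\<Sum>k\<in>I. (a k + b k) powr p) powr (1 / p) \<le> ((A + B) powr p) powr (1 / p)"
      using p by (intro powr_mono2) (auto intro: sum_nonneg)
    then show ?thesis
      using pos p by (simp add: powr_powr A_def B_def)
  qed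
qed

lemma lp_sum_simps:
  "u \<in> carrier (lp_sum p d Y) \<longleftrightarrow> u \<in> extensional {1..d} \<and> (\<forall>k\<in>{1..d}. u k \<in> carrier (Y k))"
  "\<zero>\<^bsub>lp_sum p d Y\<^esub> = (\<lambda>k\<in>{1..d}. \<zero>\<^bsub>Y k\<^esub>)"
  "u \<oplus>\<^bsub>lp_sum p d Y\<^esub> v = (\<lambda>k\<in>{1..d}. u k \<oplus>\<^bsub>Y k\<^esub> v k)"
  "c \<odot>\<^bsub>lp_sum p d Y\<^esub> u = (\<lambda>k\<in>{1..d}. c \<odot>\<^bsub>Y k\<^esub> u k)"
  "\<parallel>u\<parallel>\<^bsub>lp_sum p d Y\<^esub> = (\<Sum>k=1..d. \<parallel>u k\<parallel>\<^bsub>Y k\<^esub> powr p) powr (1 / p)"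
  by (auto simp: lp_sum_def PiE_def Pi_def)

lemma lp_norm_powr:
  assumes "1 \<le> p"
  shows "\<parallel>u\<parallel>\<^bsub>lp_sum p d Y\<^esub> powr p = (\<Sum>k=1..d. \<parallel>u k\<parallel>\<^bsub>Y k\<^esub> powr p)"
  using assms by (simp add: lp_sum_simps powr_powr sum_nonneg)

lemma lp_sum_eqI:
  assumes "u \<in> extensional {1..d}" "v \<in> extensional {1..d}" "\<And>k. k \<in> {1..d} \<Longrightarrow> u k = v k"
  shows "u = v"
  using extensionalityI[OF assms] .

lemma normed_lp_sum:
  assumes field: "F = \<real> \<or> F = UNIV" and p: "1 \<le> p"
    and Y: "\<And>k. k \<in> {1..d} \<Longrightarrow> normed_space F (Y k)"
  shows "normed_space F (lp_sum p d Y)"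
proof -
  have sp: "0 < 1 / p" "p \<noteq> 0" using p by auto
  note ns = normed_space.vnorm_nonneg[OF Y] normed_space.smult_simps[OF Y] normed_space.vnorm_smult[OF Y]
  have ab: "abelian_group (Y k)" if "k \<in> {1..d}" for k
    using Y[OF that] by (simp add: normed_space_def module_def)
  note gs = abelian_groupE[OF ab]
  show ?thesis
  proof (rule normed_spaceI)
    fix u v assume uv: "u \<in> carrier (lp_sum p d Y)" "v \<in> carrier (lp_sum p d Y)"
    have "\<parallel>u \<oplus>\<^bsub>lp_sum p d Y\<^esub> v\<parallel>\<^bsub>lp_sum p d Y\<^esub> \<le> (\<Sum>k=1..d. (\<parallel>u k\<parallel>\<^bsub>Y k\<^esub> + \<parallel>v k\<parallel>\<^bsub>Y k\<^esub>) powr p) powr (1 / p)"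
      unfolding lp_sum_simps(3,5)
    proof (intro powr_mono2 sum_mono sum_nonneg)
      fix k assume k: "k \<in> {1..d}"
      then show "\<parallel>(\<lambda>k\<in>{1..d}. u k \<oplus>\<^bsub>Y k\<^esub> v k) k\<parallel>\<^bsub>Y k\<^esub> \<le> \<parallel>u k\<parallel>\<^bsub>Y k\<^esub> + \<parallel>v k\<parallel>\<^bsub>Y k\<^esub>"
        using uv normed_space.vnorm_triangle[OF Y[OF k]] by (simp add: lp_sum_simps)
      show "0 \<le> \<parallel>(\<lambda>k\<in>{1..d}. u k \<oplus>\<^bsub>Y k\<^esub> v k) k\<parallel>\<^bsub>Y k\<^esub>"
        using k uv gs(1)[OF k] ns(1)[OF k] by (simp add: lp_sum_simps)
    qed (use p in auto)
    also have "\<dots> \<le> \<parallel>u\<parallel>\<^bsub>lp_sum p d Y\<^esub> + \<parallel>v\<parallel>\<^bsub>lp_sum p d Y\<^esub>"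
      unfolding lp_sum_simps(5)
      by (rule minkowski_inequality[OF p]) (use uv ns(1) in \<open>auto simp: lp_sum_simps\<close>)
    finally show "\<parallel>u \<oplus>\<^bsub>lp_sum p d Y\<^esub> v\<parallel>\<^bsub>lp_sum p d Y\<^esub> \<le> \<parallel>u\<parallel>\<^bsub>lp_sum p d Y\<^esub> + \<parallel>v\<parallel>\<^bsub>lp_sum p d Y\<^esub>" .
  next
    fix u assume u: "u \<in> carrier (lp_sum p d Y)" and z: "\<parallel>u\<parallel>\<^bsub>lp_sum p d Y\<^esub> = 0"
    have "u k = \<zero>\<^bsub>Y k\<^esub>" if k: "k \<in> {1..d}" for k
    proof -
      have "\<parallel>u k\<parallel>\<^bsub>Y k\<^esub> = 0"
        using z k by (simp add: lp_sum_simps sum_nonneg_eq_0_iff)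
      then show ?thesis
        using normed_space.vnorm_eq_zeroD[OF Y[OF k]] u k by (simp add: lp_sum_simps)
    qed
    then show "u = \<zero>\<^bsub>lp_sum p d Y\<^esub>"
      using u by (intro lp_sum_eqI[of _ d]) (auto simp: lp_sum_simps)
  next
    fix c u assume c: "c \<in> F" and u: "u \<in> carrier (lp_sum p d Y)"
    have "(\<Sum>k=1..d. \<parallel>(\<lambda>k\<in>{1..d}. c \<odot>\<^bsub>Y k\<^esub> u k) k\<parallel>\<^bsub>Y k\<^esub> powr p) = (\<Sum>k=1..d. cmod c powr p * \<parallel>u k\<parallel>\<^bsub>Y k\<^esub> powr p)"
    proof (intro sum.cong refl)
      fix k assume k: "k \<in> {1..d}"
      then show "\<parallel>(\<lambda>k\<in>{1..d}. c \<odot>\<^bsub>Y k\<^esub> u k) k\<parallel>\<^bsub>Y k\<^esub> powr p = cmod c powr p * \<parallel>u k\<parallel>\<^bsub>Y k\<^esub> powr p"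
        using normed_space.vnorm_smult[OF Y[OF k] c] ns(1)[OF k] u by (simp add: lp_sum_simps powr_mult)
    qed
    also have "\<dots> = cmod c powr p * (\<Sum>k=1..d. \<parallel>u k\<parallel>\<^bsub>Y k\<^esub> powr p)"
      by (simp add: sum_distrib_left)
    finally show "\<parallel>c \<odot>\<^bsub>lp_sum p d Y\<^esub> u\<parallel>\<^bsub>lp_sum p d Y\<^esub> = cmod c * \<parallel>u\<parallel>\<^bsub>lp_sum p d Y\<^esub>"
      using sp by (simp add: lp_sum_simps(4,5) powr_mult powr_powr sum_nonneg)
  next
    fix u v w assume u: "u \<in> carrier (lp_sum p d Y)" and v: "v \<in> carrier (lp_sum p d Y)" and w: "w \<in> carrier (lp_sum p d Y)"
    show "(u \<oplus>\<^bsub>lp_sum p d Y\<^esub> v) \<oplus>\<^bsub>lp_sum p d Y\<^esub> w = u \<oplus>\<^bsub>lp_sum p d Y\<^esub> (v \<oplus>\<^bsub>lp_sum p d Y\<^esub> w)"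
      using u v w gs(3) by (intro lp_sum_eqI[of _ d]) (simp_all add: lp_sum_simps)
  next
    fix u v assume u: "u \<in> carrier (lp_sum p d Y)" and v: "v \<in> carrier (lp_sum p d Y)"
    show "u \<oplus>\<^bsub>lp_sum p d Y\<^esub> v \<in> carrier (lp_sum p d Y)"
      using u v gs(1) by (simp add: lp_sum_simps)
    show "u \<oplus>\<^bsub>lp_sum p d Y\<^esub> v = v \<oplus>\<^bsub>lp_sum p d Y\<^esub> u"
      using u v gs(4) by (intro lp_sum_eqI[of _ d]) (simp_all add: lp_sum_simps)
    fix a assume a: "a \<in> F"
    show "a \<odot>\<^bsub>lp_sum p d Y\<^esub> (u \<oplus>\<^bsub>lp_sum p d Y\<^esub> v) = a \<odot>\<^bsub>lp_sum p d Y\<^esub> u \<oplus>\<^bsub>lp_sum p d Y\<^esub> a \<odot>\<^bsub>lp_sum p d Y\<^esub> v"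
      using u v a ns(5) by (intro lp_sum_eqI[of _ d]) (simp_all add: lp_sum_simps)
  next
    fix u assume u: "u \<in> carrier (lp_sum p d Y)"
    show "\<zero>\<^bsub>lp_sum p d Y\<^esub> \<oplus>\<^bsub>lp_sum p d Y\<^esub> u = u" "0 \<odot>\<^bsub>lp_sum p d Y\<^esub> u = \<zero>\<^bsub>lp_sum p d Y\<^esub>" "1 \<odot>\<^bsub>lp_sum p d Y\<^esub> u = u"
      using u gs(5) ns(6,7) by (auto intro!: lp_sum_eqI[of _ d] simp: lp_sum_simps)
    fix a b assume a: "a \<in> F" and b: "b \<in> F"
    show "a \<odot>\<^bsub>lp_sum p d Y\<^esub> u \<in> carrier (lp_sum p d Y)"
      using u a ns(2) by (simp add: lp_sum_simps)
    show "(a + b) \<odot>\<^bsub>lp_sum p d Y\<^esub> u = a \<odot>\<^bsub>lp_sum p d Y\<^esub> u \<oplus>\<^bsub>lp_sum p d Y\<^esub> b \<odot>\<^bsub>lp_sum p d Y\<^esub> u"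
      using u a b ns(3) by (intro lp_sum_eqI[of _ d]) (simp_all add: lp_sum_simps)
    show "(a * b) \<odot>\<^bsub>lp_sum p d Y\<^esub> u = a \<odot>\<^bsub>lp_sum p d Y\<^esub> (b \<odot>\<^bsub>lp_sum p d Y\<^esub> u)"
      using u a b ns(4) by (intro lp_sum_eqI[of _ d]) (simp_all add: lp_sum_simps)
  next
    show "\<zero>\<^bsub>lp_sum p d Y\<^esub> \<in> carrier (lp_sum p d Y)"
      using gs(2) by (simp add: lp_sum_simps)
  qed (rule field)
qed

section \<open>Compact operators\<close>

context normed_space
begin

lemma metric: "Metric_space (carrier V) (vdist V)"
proof
  fix x y z
  show "0 \<le> vdist V x y" "vdist V x y = vdist V y x"
    by (auto simp: vdist_def vnorm_minus_commute)
  show "(vdist V x y = 0) = (x = y)" if "x \<in> carrier V" "y \<in> carrier V"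
    using that vnorm_eq_zeroD[of "x \<ominus> y"] minus_eq_zero_imp_eq[of x y] by (auto simp: vdist_def r_neg minus_eq)
  show "vdist V x z \<le> vdist V x y + vdist V y z"
    if "x \<in> carrier V" "y \<in> carrier V" "z \<in> carrier V"
  proof -
    have "x \<ominus> z = (x \<ominus> y) \<oplus> (y \<ominus> z)"
      using that by (simp add: minus_eq a_assoc r_neg1)
    then show ?thesis
      using vnorm_triangle[of "x \<ominus> y" "y \<ominus> z"] that by (simp add: vdist_def)
  qed
qed

lemmas topspace_norm_topology [simp] = Metric_space.topspace_mtopology[OF metric, folded norm_topology_def]
lemmas Hausdorff_norm_topology = Metric_space.Hausdorff_space_mtopology[OF metric, folded norm_topology_def]
lemmas compactin_sequentially = Metric_space.compactin_sequentially[OF metric, folded norm_topology_def]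
lemmas limitin_norm_topology = Metric_space.limitin_metric[OF metric, folded norm_topology_def]
lemmas compactin_imp_mbounded = Metric_space.compactin_imp_mbounded[OF metric, folded norm_topology_def]
lemmas mbounded_alt_pos = Metric_space.mbounded_alt_pos[OF metric]

lemma vdist_eq: "x \<in> carrier V \<Longrightarrow> y \<in> carrier V \<Longrightarrow> vdist V x y = \<parallel>x \<ominus> y\<parallel>"
  by (simp add: vdist_def)

lemma compactin_closure_of_subset:
  assumes "A \<subseteq> K" "compactin (norm_topology V) K"
  shows "compactin (norm_topology V) (norm_topology V closure_of A)"
proof -
  have "closedin (norm_topology V) K"
    using assms(2) Hausdorff_norm_topology by (simp add: compactin_imp_closedin)
  then have "norm_topology V closure_of A \<subseteq> K"
    using assms(1) closure_of_minimal by blast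
  then show ?thesis
    using assms(2) closed_compactin closedin_closure_of by blast
qed

text \<open>
  Take a convergent subsequence of the first summands, and from it one of the second summands.
\<close>

lemma compactin_sum:
  assumes K: "compactin (norm_topology V) K" and L: "compactin (norm_topology V) L"
  shows "compactin (norm_topology V) ((\<lambda>(x, y). x \<oplus> y) ` (K \<times> L))"
  unfolding compactin_sequentially
proof (intro conjI allI impI)
  have KL: "K \<subseteq> carrier V" "L \<subseteq> carrier V"
    using K L by (simp_all add: compactin_sequentially)
  then show "(\<lambda>(x, y). x \<oplus> y) ` (K \<times> L) \<subseteq> carrier V"
    by auto
  fix \<sigma> :: "nat \<Rightarrow> 'a" assume "range \<sigma> \<subseteq> (\<lambda>(x, y). x \<oplus> y) ` (K \<times> L)"
  then have "\<forall>n. \<exists>x y. x \<in> K \<and> y \<in> L \<and> \<sigma> n = x \<oplus> y"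
    by (fastforce simp: image_subset_iff)
  then obtain a b where ab: "\<And>n. a n \<in> K" "\<And>n. b n \<in> L" "\<And>n. \<sigma> n = a n \<oplus> b n"
    by metis
  obtain l r where l: "l \<in> K" and r: "strict_mono (r :: nat \<Rightarrow> nat)"
    and lim_a: "limitin (norm_topology V) (a \<circ> r) l sequentially"
    using K ab(1) unfolding compactin_sequentially by (metis image_subset_iff)
  obtain m s where m: "m \<in> L" and s: "strict_mono (s :: nat \<Rightarrow> nat)"
    and lim_b: "limitin (norm_topology V) ((b \<circ> r) \<circ> s) m sequentially"
    using L ab(2) unfolding compactin_sequentially by (metis comp_apply image_subset_iff)
  have lim_a': "limitin (norm_topology V) ((a \<circ> r) \<circ> s) l sequentially"
    using limitin_subsequence[OF s lim_a] .
  have lm: "l \<in> carrier V" "m \<in> carrier V" using l m KL by auto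
  have "limitin (norm_topology V) (\<sigma> \<circ> (r \<circ> s)) (l \<oplus> m) sequentially"
    unfolding limitin_norm_topology
  proof (intro conjI allI impI)
    show "l \<oplus> m \<in> carrier V" using lm by simp
    fix e :: real assume e: "0 < e"
    have "\<forall>\<^sub>F n in sequentially. a (r (s n)) \<in> carrier V \<and> vdist V (a (r (s n))) l < e / 2"
      using lim_a' half_gt_zero[OF e] unfolding limitin_norm_topology comp_apply by blast
    moreover have "\<forall>\<^sub>F n in sequentially. b (r (s n)) \<in> carrier V \<and> vdist V (b (r (s n))) m < e / 2"
      using lim_b half_gt_zero[OF e] unfolding limitin_norm_topology comp_apply by blast
    ultimately show "\<forall>\<^sub>F n in sequentially. (\<sigma> \<circ> (r \<circ> s)) n \<in> carrier V \<and> vdist V ((\<sigma> \<circ> (r \<circ> s)) n) (l \<oplus> m) < e"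
    proof eventually_elim
      case (elim n)
      define x where "x = a (r (s n))"
      define y where "y = b (r (s n))"
      have xy: "x \<in> carrier V" "y \<in> carrier V" using ab KL by (auto simp: x_def y_def)
      have "(x \<oplus> y) \<ominus> (l \<oplus> m) = (x \<ominus> l) \<oplus> (y \<ominus> m)"
        using xy lm by (simp add: minus_eq minus_add a_ac)
      then have "vdist V (x \<oplus> y) (l \<oplus> m) \<le> vdist V x l + vdist V y m"
        using vnorm_triangle[of "x \<ominus> l" "y \<ominus> m"] xy lm by (simp add: vdist_eq)
      then show ?case
        using elim xy ab(3) by (simp add: x_def y_def)
    qed
  qed
  then show "\<exists>l r. l \<in> (\<lambda>(x, y). x \<oplus> y) ` (K \<times> L) \<and> strict_mono r \<and> limitin (norm_topology V) (\<sigma> \<circ> r) l sequentially"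
    using l m strict_mono_o[OF r s] by (intro exI[of _ "l \<oplus> m"] exI[of _ "r \<circ> s"]) auto
qed

end

lemma (in normed_space_pair) continuous_bounded_op:
  assumes T: "T \<in> bounded_ops F V W"
  shows "continuous_map (norm_topology V) (norm_topology W) T"
proof (subst Metric_space.metric_continuous_map[OF V.metric W.metric, folded norm_topology_def], intro conjI ballI allI impI)
  note lin = bounded_opsD(1)[OF T]
  show "T ` carrier V \<subseteq> carrier W"
    using linear_opsD(1)[OF lin] by auto
  fix a and e :: real assume a: "a \<in> carrier V" and e: "0 < e"
  define C where "C = op_norm V W T + 1"
  have C: "0 < C" using op_norm_nonneg[OF T] by (simp add: C_def)
  show "\<exists>\<delta>>0. \<forall>x. x \<in> carrier V \<and> vdist V a x < \<delta> \<longrightarrow> vdist W (T a) (T x) < e"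
  proof (intro exI[of _ "e / C"] conjI allI impI)
    show "0 < e / C" using e C by simp
    fix x assume x: "x \<in> carrier V \<and> vdist V a x < e / C"
    have "vdist W (T a) (T x) = \<parallel>T (a \<ominus>\<^bsub>V\<^esub> x)\<parallel>\<^bsub>W\<^esub>"
      using a x by (simp add: W.vdist_eq linear_opsD(1)[OF lin] linear_ops_minus[OF lin])
    also have "\<dots> \<le> op_norm V W T * \<parallel>a \<ominus>\<^bsub>V\<^esub> x\<parallel>\<^bsub>V\<^esub>"
      by (rule op_norm_bound[OF T]) (use a x in simp)
    also have "\<dots> \<le> C * vdist V a x"
      using a x by (simp add: V.vdist_eq C_def mult_right_mono)
    also have "\<dots> < e"
      using x C by (simp add: field_simps)
    finally show "vdist W (T a) (T x) < e" .
  qed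
qed

context normed_space_pair
begin

lemma compact_opsI:
  assumes "T \<in> linear_ops F V W" "T ` unit_ball V \<subseteq> K" "compactin (norm_topology W) K"
  shows "T \<in> compact_ops F V W"
  using assms W.compactin_closure_of_subset by (simp add: compact_ops_def)

lemma compact_opsD:
  assumes "T \<in> compact_ops F V W"
  shows "T \<in> linear_ops F V W" "T ` unit_ball V \<subseteq> norm_topology W closure_of (T ` unit_ball V)"
    "compactin (norm_topology W) (norm_topology W closure_of (T ` unit_ball V))"
proof -
  show lin: "T \<in> linear_ops F V W"
    and "compactin (norm_topology W) (norm_topology W closure_of (T ` unit_ball V))"
    using assms by (simp_all add: compact_ops_def)
  have "T ` unit_ball V \<subseteq> topspace (norm_topology W)"
    using linear_opsD(1)[OF lin] by (auto simp: unit_ball_def)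
  then show "T ` unit_ball V \<subseteq> norm_topology W closure_of (T ` unit_ball V)"
    by (rule closure_of_subset)
qed

lemma compact_ops_bounded:
  assumes T: "T \<in> compact_ops F V W"
  shows "T \<in> bounded_ops F V W"
proof -
  obtain K where lin: "T \<in> linear_ops F V W" and K: "T ` unit_ball V \<subseteq> K" "compactin (norm_topology W) K"
    using compact_opsD[OF T] by blast
  have zero: "\<zero>\<^bsub>W\<^esub> \<in> K"
    using K(1) zero_in_unit_ball linear_ops_zero[OF lin] by (metis image_subset_iff)
  have "Metric_space.mbounded (carrier W) (vdist W) K"
    using K(2) by (rule W.compactin_imp_mbounded)
  then obtain B where B: "\<And>y. y \<in> K \<Longrightarrow> vdist W \<zero>\<^bsub>W\<^esub> y \<le> B"
    using zero unfolding W.mbounded_alt_pos by blast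
  have ball: "\<parallel>T x\<parallel>\<^bsub>W\<^esub> \<le> B" if x: "x \<in> unit_ball V" for x
  proof -
    have "T x \<in> carrier W" using x linear_opsD(1)[OF lin] by (simp add: unit_ball_def)
    then show ?thesis
      using B[of "T x"] K(1) x W.vnorm_minus_commute[of "\<zero>\<^bsub>W\<^esub>" "T x"]
      by (auto simp: W.vdist_eq W.minus_as_smult W.smult_simps)
  qed
  show ?thesis
    by (rule bounded_opsI[OF lin unit_ball_bound[OF lin ball]])
qed

lemma compact_ops_zero: "zero_op \<in> compact_ops F V W"
proof (rule compact_opsI[OF linear_ops_closed(1)])
  show "zero_op ` unit_ball V \<subseteq> {\<zero>\<^bsub>W\<^esub>}"
    by (auto simp: unit_ball_def op_apply)
  show "compactin (norm_topology W) {\<zero>\<^bsub>W\<^esub>}"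
    by simp
qed

lemma compact_ops_add:
  assumes S: "S \<in> compact_ops F V W" and T: "T \<in> compact_ops F V W"
  shows "add_op S T \<in> compact_ops F V W"
proof -
  obtain K where K: "S \<in> linear_ops F V W" "S ` unit_ball V \<subseteq> K" "compactin (norm_topology W) K"
    using compact_opsD[OF S] by blast
  obtain L where L: "T \<in> linear_ops F V W" "T ` unit_ball V \<subseteq> L" "compactin (norm_topology W) L"
    using compact_opsD[OF T] by blast
  show ?thesis
  proof (rule compact_opsI[OF linear_ops_closed(2)[OF K(1) L(1)]])
    show "add_op S T ` unit_ball V \<subseteq> (\<lambda>(x, y). x \<oplus>\<^bsub>W\<^esub> y) ` (K \<times> L)"
      using K(2) L(2) by (fastforce simp: unit_ball_def op_apply)
  qed (rule W.compactin_sum[OF K(3) L(3)])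
qed

lemma compact_ops_compose:
  assumes T: "T \<in> compact_ops F V W" and U: "normed_space F U" and R: "R \<in> bounded_ops F W U"
  shows "(\<lambda>x\<in>carrier V. R (T x)) \<in> compact_ops F V U"
proof -
  interpret U: normed_space F U by (rule U)
  interpret WU: normed_space_pair F W U by unfold_locales
  interpret VU: normed_space_pair F V U by unfold_locales
  obtain K where K: "T \<in> linear_ops F V W" "T ` unit_ball V \<subseteq> K" "compactin (norm_topology W) K"
    using compact_opsD[OF T] by blast
  note Rl = WU.bounded_opsD(1)[OF R]
  show ?thesis
  proof (rule VU.compact_opsI)
    show "(\<lambda>x\<in>carrier V. R (T x)) \<in> linear_ops F V U"
      by (rule VU.linear_opsI) (auto simp: linear_opsD[OF K(1)] linear_opsD[OF Rl])
    show "(\<lambda>x\<in>carrier V. R (T x)) ` unit_ball V \<subseteq> R ` K"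
      using K(2) by (auto simp: unit_ball_def)
    show "compactin (norm_topology U) (R ` K)"
      by (rule image_compactin[OF K(3) WU.continuous_bounded_op[OF R]])
  qed
qed

lemma compact_ops_smult:
  assumes c: "c \<in> F" and T: "T \<in> compact_ops F V W"
  shows "smult_op c T \<in> compact_ops F V W"
proof -
  interpret WW: normed_space_pair F W W by unfold_locales
  have lin: "T \<in> linear_ops F V W" using T by (simp add: compact_ops_def)
  have "(\<lambda>w\<in>carrier W. c \<odot>\<^bsub>W\<^esub> w) \<in> linear_ops F W W"
    by (rule WW.linear_opsI) (use c in \<open>auto simp: W.smult_simps mult.commute\<close>)
  then have "(\<lambda>w\<in>carrier W. c \<odot>\<^bsub>W\<^esub> w) \<in> bounded_ops F W W"
    by (rule WW.bounded_opsI[where B = "cmod c"]) (use c in \<open>simp add: W.vnorm_smult\<close>)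
  from compact_ops_compose[OF T W.normed_space_axioms this]
  have "(\<lambda>x\<in>carrier V. (\<lambda>w\<in>carrier W. c \<odot>\<^bsub>W\<^esub> w) (T x)) \<in> compact_ops F V W" .
  moreover have "(\<lambda>x\<in>carrier V. (\<lambda>w\<in>carrier W. c \<odot>\<^bsub>W\<^esub> w) (T x)) = smult_op c T"
    using linear_opsD(1)[OF lin] by (auto simp: smult_op_def fun_eq_iff)
  ultimately show ?thesis by simp
qed

lemma normed_compact_op_space: "normed_space F (compact_op_space F V W)"
  unfolding compact_op_space_def
  by (rule normed_op_space) (use compact_ops_bounded compact_ops_zero compact_ops_add compact_ops_smult in auto)

text \<open>
  The norms \<open>\<parallel>T x\<parallel>\<close> approach \<open>op_norm V W T\<close> along a sequence in the unit ball; compactness gives a limit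
  point \<open>y\<close> of the images.  Whether \<open>y\<close> is itself an image is left open here.
\<close>

lemma compact_op_norm_limit:
  assumes T: "T \<in> compact_ops F V W"
  obtains y where "y \<in> carrier W" "\<parallel>y\<parallel>\<^bsub>W\<^esub> = op_norm V W T"
    "\<And>e. 0 < e \<Longrightarrow> \<exists>x\<in>unit_ball V. \<parallel>y \<ominus>\<^bsub>W\<^esub> T x\<parallel>\<^bsub>W\<^esub> < e"
proof -
  note bdd = compact_ops_bounded[OF T]
  obtain K where lin: "T \<in> linear_ops F V W" and K: "T ` unit_ball V \<subseteq> K" "compactin (norm_topology W) K"
    using compact_opsD[OF T] by blast
  have cl: "T x \<in> carrier W" if "x \<in> unit_ball V" for x
    using that linear_opsD(1)[OF lin] by (simp add: unit_ball_def)
  let ?N = "op_norm V W T"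
  have "\<exists>x\<in>unit_ball V. ?N - inverse (Suc n) < \<parallel>T x\<parallel>\<^bsub>W\<^esub>" for n :: nat
  proof (rule ccontr)
    assume "\<not> ?thesis"
    then have "?N \<le> ?N - inverse (Suc n)"
      by (intro op_norm_leI) (force simp: unit_ball_def)
    then show False by simp
  qed
  then obtain x where x: "\<And>n. x n \<in> unit_ball V" "\<And>n::nat. ?N - inverse (Suc n) < \<parallel>T (x n)\<parallel>\<^bsub>W\<^esub>"
    by metis
  have "range (\<lambda>n. T (x n)) \<subseteq> K" using K(1) x(1) by blast
  then obtain y r where y: "y \<in> K" and r: "strict_mono (r :: nat \<Rightarrow> nat)"
    and lim: "limitin (norm_topology W) ((\<lambda>n. T (x n)) \<circ> r) y sequentially"
    using K(2) unfolding W.compactin_sequentially by metis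
  have yW: "y \<in> carrier W" and dist: "\<And>e. 0 < e \<Longrightarrow> \<forall>\<^sub>F n in sequentially. \<parallel>T (x (r n)) \<ominus>\<^bsub>W\<^esub> y\<parallel>\<^bsub>W\<^esub> < e"
    using lim cl[OF x(1)] by (auto simp: W.limitin_norm_topology W.vdist_eq)
  have close: "\<exists>z\<in>unit_ball V. \<parallel>y \<ominus>\<^bsub>W\<^esub> T z\<parallel>\<^bsub>W\<^esub> < e" if "0 < e" for e
    using eventually_happens'[OF _ dist[OF that]] x(1) cl[OF x(1)] yW
    by (metis W.vnorm_minus_commute trivial_limit_sequentially)
  have "\<parallel>y\<parallel>\<^bsub>W\<^esub> \<le> ?N"
  proof (rule field_le_epsilon)
    fix e :: real assume "0 < e"
    then obtain z where z: "z \<in> unit_ball V" "\<parallel>y \<ominus>\<^bsub>W\<^esub> T z\<parallel>\<^bsub>W\<^esub> < e" using close by blast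
    show "\<parallel>y\<parallel>\<^bsub>W\<^esub> \<le> ?N + e"
      using W.vnorm_minus_triangle[OF yW cl[OF z(1)]] le_op_norm[OF bdd z(1)] z(2) by linarith
  qed
  moreover have "?N \<le> \<parallel>y\<parallel>\<^bsub>W\<^esub>"
  proof (rule field_le_epsilon)
    fix e :: real assume e: "0 < e"
    then have "\<forall>\<^sub>F n in sequentially. inverse (real (Suc n)) < e / 2"
      using order_tendstoD(2)[OF LIMSEQ_inverse_real_of_nat, of "e / 2"] by simp
    moreover have "\<forall>\<^sub>F n in sequentially. \<parallel>T (x (r n)) \<ominus>\<^bsub>W\<^esub> y\<parallel>\<^bsub>W\<^esub> < e / 2"
      using dist[of "e / 2"] e by simp
    ultimately have "\<forall>\<^sub>F n in sequentially. inverse (real (Suc n)) < e / 2 \<and> \<parallel>T (x (r n)) \<ominus>\<^bsub>W\<^esub> y\<parallel>\<^bsub>W\<^esub> < e / 2"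
      by (rule eventually_conj)
    then obtain n where n: "inverse (real (Suc n)) < e / 2" "\<parallel>T (x (r n)) \<ominus>\<^bsub>W\<^esub> y\<parallel>\<^bsub>W\<^esub> < e / 2"
      using eventually_happens'[OF trivial_limit_sequentially] by blast
    have "inverse (real (Suc (r n))) \<le> inverse (real (Suc n))"
      using seq_suble[OF r, of n] by (simp add: field_simps)
    then show "?N \<le> \<parallel>y\<parallel>\<^bsub>W\<^esub> + e"
      using x(2)[of "r n"] n W.vnorm_minus_triangle[OF cl[OF x(1)] yW, of "r n"] by linarith
  qed
  ultimately show ?thesis
    using that yW close by simp
qed

text \<open>
  Let \<open>y\<close> be a limit of images \<open>T x\<close> with \<open>\<parallel>y\<parallel> = op_norm V W T\<close>, and let \<open>f\<close> norm \<open>y\<close>.  Then \<open>g = f \<circ> T\<close> has norm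
  \<open>op_norm V W T\<close>, and an extreme point of the ball at which \<open>g\<close> attains its norm is one at which \<open>T\<close>
  attains its norm, with the same \<open>f\<close> norming the image.
\<close>

lemma compact_op_extreme_norm_attainment:
  assumes refl: "reflexive F V" and T: "T \<in> compact_ops F V W"
  obtains x f where "x \<in> ball_extreme_points V" "f \<in> carrier (dual F W)"
    "\<And>w. w \<in> carrier W \<Longrightarrow> cmod (f w) \<le> \<parallel>w\<parallel>\<^bsub>W\<^esub>" "f (T x) = complex_of_real (op_norm V W T)"
proof -
  note bdd = compact_ops_bounded[OF T]
  note lin = bounded_opsD(1)[OF bdd]
  let ?N = "op_norm V W T"
  obtain y where y: "y \<in> carrier W" "\<parallel>y\<parallel>\<^bsub>W\<^esub> = ?N"
    and close: "\<And>e. 0 < e \<Longrightarrow> \<exists>x\<in>unit_ball V. \<parallel>y \<ominus>\<^bsub>W\<^esub> T x\<parallel>\<^bsub>W\<^esub> < e"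
    by (rule compact_op_norm_limit[OF T]) blast
  obtain f where f: "f \<in> carrier (dual F W)" "f y = complex_of_real \<parallel>y\<parallel>\<^bsub>W\<^esub>"
    and f_le: "\<And>w. w \<in> carrier W \<Longrightarrow> cmod (f w) \<le> \<parallel>w\<parallel>\<^bsub>W\<^esub>"
    by (rule W.norming_functional[OF y(1)]) blast
  define g where "g = (\<lambda>x\<in>carrier V. f (T x))"
  have g: "g \<in> carrier (dual F V)"
  proof (rule V.dualI[where B = ?N])
    show "g \<in> extensional (carrier V)" by (simp add: g_def)
    show "cmod (g x) \<le> ?N * \<parallel>x\<parallel>\<^bsub>V\<^esub>" if "x \<in> carrier V" for x
      using order_trans[OF f_le[OF linear_opsD(1)[OF lin that]] op_norm_bound[OF bdd that]] that
      by (simp add: g_def)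
  qed (auto simp: g_def linear_opsD[OF lin] W.dualD[OF f(1)])
  have g_le: "cmod (g x) \<le> ?N" if "x \<in> unit_ball V" for x
  proof -
    have x: "x \<in> carrier V" using that by (simp add: unit_ball_def)
    show ?thesis
      using order_trans[OF f_le[OF linear_opsD(1)[OF lin x]] le_op_norm[OF bdd that]] x by (simp add: g_def)
  qed
  have "?N \<le> \<parallel>g\<parallel>\<^bsub>dual F V\<^esub>"
  proof (rule field_le_epsilon)
    fix e :: real assume "0 < e"
    then obtain x where x: "x \<in> unit_ball V" "\<parallel>y \<ominus>\<^bsub>W\<^esub> T x\<parallel>\<^bsub>W\<^esub> < e" using close by blast
    have xV: "x \<in> carrier V" "\<parallel>x\<parallel>\<^bsub>V\<^esub> \<le> 1" using x by (auto simp: unit_ball_def)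
    have Tx: "T x \<in> carrier W" using linear_opsD(1)[OF lin xV(1)] .
    have "?N = cmod (f (y \<ominus>\<^bsub>W\<^esub> T x) + g x)"
      using f(2) y op_norm_nonneg[OF bdd] W.dual_minus[OF f(1) y(1) Tx] xV by (simp add: g_def)
    also have "\<dots> \<le> cmod (f (y \<ominus>\<^bsub>W\<^esub> T x)) + cmod (g x)"
      by (rule norm_triangle_ineq)
    also have "\<dots> \<le> e + \<parallel>g\<parallel>\<^bsub>dual F V\<^esub>"
    proof (rule add_mono)
      show "cmod (f (y \<ominus>\<^bsub>W\<^esub> T x)) \<le> e"
        using f_le[of "y \<ominus>\<^bsub>W\<^esub> T x"] x(2) y(1) Tx by simp
      have "0 \<le> \<parallel>g\<parallel>\<^bsub>dual F V\<^esub>"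
        using normed_space.vnorm_nonneg[OF V.normed_dual g] .
      then show "cmod (g x) \<le> \<parallel>g\<parallel>\<^bsub>dual F V\<^esub>"
        using V.dualD(4)[OF g xV(1)] xV(2) mult_left_le[of "\<parallel>x\<parallel>\<^bsub>V\<^esub>" "\<parallel>g\<parallel>\<^bsub>dual F V\<^esub>"] by linarith
    qed
    finally show "?N \<le> \<parallel>g\<parallel>\<^bsub>dual F V\<^esub> + e" by simp
  qed
  moreover have "\<parallel>g\<parallel>\<^bsub>dual F V\<^esub> \<le> ?N"
    by (rule V.dual_norm_le) (use g_le in \<open>simp add: unit_ball_def\<close>)
  ultimately have gN: "\<parallel>g\<parallel>\<^bsub>dual F V\<^esub> = ?N" by simp
  obtain x where x: "x \<in> ball_extreme_points V" "Re (g x) = \<parallel>g\<parallel>\<^bsub>dual F V\<^esub>"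
    by (rule V.extreme_norming_point[OF refl g])
  then have xb: "x \<in> unit_ball V" by (simp add: ball_extreme_points_def)
  have "g x = complex_of_real ?N"
    using x(2) gN g_le[OF xb] by (intro complex_of_norm_bound) auto
  then have "f (T x) = complex_of_real ?N"
    using xb by (simp add: g_def unit_ball_def)
  then show ?thesis
    using that x(1) f(1) f_le by blast
qed

end

section \<open>Smooth best approximations by compact operators\<close>

text \<open>
  Two support functionals at \<open>T\<close> are available.  Since \<open>T\<close> is at distance \<open>\<parallel>T\<parallel>\<close> from the subspace \<open>M\<close>, there is
  one, \<open>\<phi>\<close>, that vanishes on \<open>M\<close>.  Another, \<open>\<psi>\<close>, is the evaluation \<open>A \<mapsto> f (A x)\<close> at an extreme point \<open>x\<close> where
  \<open>T\<close> attains its norm, with \<open>f\<close> norming \<open>T x\<close>.  Smoothness identifies them, so \<open>f\<close> vanishes on every \<open>A x\<close>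
  with \<open>A \<in> M\<close>, and \<open>f\<close> witnesses that \<open>T x\<close> is at distance \<open>\<parallel>T x\<parallel>\<close> from \<open>{A x | A. A \<in> M}\<close>.
\<close>

theorem (in normed_space_pair) smooth_best_approximation_pointwise:
  defines "K \<equiv> compact_op_space F V W"
  assumes refl: "reflexive F V" and smooth: "smooth F K T"
    and M: "M \<subseteq> carrier K" "M \<noteq> {}" "\<And>A B. A \<in> M \<Longrightarrow> B \<in> M \<Longrightarrow> A \<oplus>\<^bsub>K\<^esub> B \<in> M"
      "\<And>c A. c \<in> F \<Longrightarrow> A \<in> M \<Longrightarrow> c \<odot>\<^bsub>K\<^esub> A \<in> M"
    and best: "\<And>A. A \<in> M \<Longrightarrow> \<parallel>T\<parallel>\<^bsub>K\<^esub> \<le> \<parallel>T \<oplus>\<^bsub>K\<^esub> A\<parallel>\<^bsub>K\<^esub>"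
  obtains x where "x \<in> norm_attainment V W T" "x \<in> ball_extreme_points V"
    "\<And>A. A \<in> M \<Longrightarrow> \<parallel>T x\<parallel>\<^bsub>W\<^esub> \<le> \<parallel>T x \<oplus>\<^bsub>W\<^esub> A x\<parallel>\<^bsub>W\<^esub>"
proof -
  interpret K: normed_space F K
    unfolding K_def by (rule normed_compact_op_space)
  have K_simps: "carrier K = compact_ops F V W" "\<And>A. \<parallel>A\<parallel>\<^bsub>K\<^esub> = op_norm V W A"
    "\<And>A B. A \<oplus>\<^bsub>K\<^esub> B = add_op A B" "\<And>c A. c \<odot>\<^bsub>K\<^esub> A = smult_op c A"
    by (simp_all add: K_def compact_op_space_def op_space_simps)
  have T: "T \<in> compact_ops F V W" "T \<in> carrier K" "T \<noteq> \<zero>\<^bsub>K\<^esub>"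
    using smooth by (auto simp: smooth_def K_simps)
  note bdd = compact_ops_bounded[OF T(1)]
  note lin = bounded_opsD(1)[OF bdd]
  obtain \<phi> where \<phi>: "\<phi> \<in> carrier (dual F K)" "\<phi> T = complex_of_real \<parallel>T\<parallel>\<^bsub>K\<^esub>"
    "\<And>A. A \<in> carrier K \<Longrightarrow> cmod (\<phi> A) \<le> \<parallel>A\<parallel>\<^bsub>K\<^esub>" and \<phi>_M: "\<And>A. A \<in> M \<Longrightarrow> \<phi> A = 0"
    by (rule K.best_approximation_functional[OF T(2) M best]) blast+
  obtain x f where x: "x \<in> ball_extreme_points V" and f: "f \<in> carrier (dual F W)"
    "\<And>w. w \<in> carrier W \<Longrightarrow> cmod (f w) \<le> \<parallel>w\<parallel>\<^bsub>W\<^esub>" "f (T x) = complex_of_real (op_norm V W T)"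
    by (rule compact_op_extreme_norm_attainment[OF refl T(1)]) blast
  have xb: "x \<in> unit_ball V" using x by (simp add: ball_extreme_points_def)
  then have xV: "x \<in> carrier V" "\<parallel>x\<parallel>\<^bsub>V\<^esub> \<le> 1" by (auto simp: unit_ball_def)
  have cl: "A x \<in> carrier W" if "A \<in> carrier K" for A
    using that linear_opsD(1)[OF bounded_opsD(1)[OF compact_ops_bounded] xV(1)] by (simp add: K_simps)
  define \<psi> where "\<psi> = (\<lambda>A\<in>carrier K. f (A x))"
  have \<psi>_le: "cmod (\<psi> A) \<le> \<parallel>A\<parallel>\<^bsub>K\<^esub>" if A: "A \<in> carrier K" for A
    using order_trans[OF f(2)[OF cl[OF A]] le_op_norm[OF compact_ops_bounded xb, of A]] A
    by (simp add: \<psi>_def K_simps)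
  have \<psi>: "\<psi> \<in> carrier (dual F K)"
  proof (rule K.dualI[where B = 1])
    show "\<psi> \<in> extensional (carrier K)" by (simp add: \<psi>_def)
    show "\<psi> A \<in> F" if "A \<in> carrier K" for A
      using that cl W.dualD(1)[OF f(1)] by (simp add: \<psi>_def)
    show "\<psi> (A \<oplus>\<^bsub>K\<^esub> B) = \<psi> A + \<psi> B" if "A \<in> carrier K" "B \<in> carrier K" for A B
    proof -
      have "(A \<oplus>\<^bsub>K\<^esub> B) x = A x \<oplus>\<^bsub>W\<^esub> B x"
        using xV by (simp add: K_simps op_apply)
      then show ?thesis
        using that cl W.dualD(2)[OF f(1)] by (simp add: \<psi>_def)
    qed
    show "\<psi> (c \<odot>\<^bsub>K\<^esub> A) = c * \<psi> A" if "c \<in> F" "A \<in> carrier K" for c A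
    proof -
      have "(c \<odot>\<^bsub>K\<^esub> A) x = c \<odot>\<^bsub>W\<^esub> A x"
        using xV by (simp add: K_simps op_apply)
      then show ?thesis
        using that cl W.dualD(3)[OF f(1)] by (simp add: \<psi>_def)
    qed
  qed (use \<psi>_le in simp)
  have "\<psi> T = complex_of_real \<parallel>T\<parallel>\<^bsub>K\<^esub>"
    using T f(3) by (simp add: \<psi>_def K_simps)
  then have "\<psi> \<in> support_functionals F K T"
    by (intro K.support_functionalsI \<psi> \<psi>_le T)
  moreover have "\<phi> \<in> support_functionals F K T"
    by (intro K.support_functionalsI \<phi> T)
  moreover have "is_singleton (support_functionals F K T)"
    using smooth by (simp add: smooth_def)
  ultimately have "\<phi> = \<psi>"
    by (auto simp: is_singleton_def)
  then have f_M: "f (A x) = 0" if "A \<in> M" for A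
    using \<phi>_M[OF that] M(1) that by (auto simp: \<psi>_def)
  have N_pos: "0 < op_norm V W T"
    using K.vnorm_eq_zeroD[OF T(2)] T(3) K.vnorm_nonneg[OF T(2)] by (auto simp: K_simps less_le)
  have attained: "\<parallel>T x\<parallel>\<^bsub>W\<^esub> = op_norm V W T"
    using f(2)[OF cl[OF T(2)]] f(3) N_pos le_op_norm[OF bdd xb] by simp
  have "op_norm V W T \<le> op_norm V W T * \<parallel>x\<parallel>\<^bsub>V\<^esub>"
    using op_norm_bound[OF bdd xV(1)] attained by simp
  then have "\<parallel>x\<parallel>\<^bsub>V\<^esub> = 1"
    using N_pos xV by simp
  then have "x \<in> norm_attainment V W T"
    using xV attained by (simp add: norm_attainment_def unit_sphere_def)
  moreover have "\<parallel>T x\<parallel>\<^bsub>W\<^esub> \<le> \<parallel>T x \<oplus>\<^bsub>W\<^esub> A x\<parallel>\<^bsub>W\<^esub>" if A: "A \<in> M" for A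
  proof -
    have "A \<in> carrier K" using A M(1) by blast
    then have "f (T x \<oplus>\<^bsub>W\<^esub> A x) = complex_of_real \<parallel>T x\<parallel>\<^bsub>W\<^esub>"
      using cl T f_M[OF A] f(3) attained W.dualD(2)[OF f(1)] by simp
    then show ?thesis
      using f(2)[of "T x \<oplus>\<^bsub>W\<^esub> A x"] cl[OF \<open>A \<in> carrier K\<close>] cl[OF T(2)] by simp
  qed
  ultimately show ?thesis
    using that x by blast
qed

section \<open>Tuples of operators into a finite direct sum\<close>

lemma lp_coordinate_norm_le:
  assumes p: "1 \<le> p" and Y: "\<And>k. k \<in> {1..d} \<Longrightarrow> normed_space F (Y k)"
    and uv: "u \<in> carrier (lp_sum p d Y)" "v \<in> carrier (lp_sum p d Y)"
    and le: "\<parallel>u\<parallel>\<^bsub>lp_sum p d Y\<^esub> \<le> \<parallel>v\<parallel>\<^bsub>lp_sum p d Y\<^esub>"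
    and j: "j \<in> {1..d}" and others: "\<And>k. k \<in> {1..d} \<Longrightarrow> k \<noteq> j \<Longrightarrow> v k = u k"
  shows "\<parallel>u j\<parallel>\<^bsub>Y j\<^esub> \<le> \<parallel>v j\<parallel>\<^bsub>Y j\<^esub>"
proof -
  have "\<parallel>u\<parallel>\<^bsub>lp_sum p d Y\<^esub> powr p \<le> \<parallel>v\<parallel>\<^bsub>lp_sum p d Y\<^esub> powr p"
    using le p by (intro powr_mono2) (auto simp: lp_sum_simps)
  then have "(\<Sum>k=1..d. \<parallel>u k\<parallel>\<^bsub>Y k\<^esub> powr p) \<le> (\<Sum>k=1..d. \<parallel>v k\<parallel>\<^bsub>Y k\<^esub> powr p)"
    by (simp only: lp_norm_powr[OF p])
  then have "\<parallel>u j\<parallel>\<^bsub>Y j\<^esub> powr p + (\<Sum>k\<in>{1..d}-{j}. \<parallel>u k\<parallel>\<^bsub>Y k\<^esub> powr p)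
      \<le> \<parallel>v j\<parallel>\<^bsub>Y j\<^esub> powr p + (\<Sum>k\<in>{1..d}-{j}. \<parallel>v k\<parallel>\<^bsub>Y k\<^esub> powr p)"
    by (simp only: sum.remove[OF finite_atLeastAtMost j])
  moreover have "(\<Sum>k\<in>{1..d}-{j}. \<parallel>v k\<parallel>\<^bsub>Y k\<^esub> powr p) = (\<Sum>k\<in>{1..d}-{j}. \<parallel>u k\<parallel>\<^bsub>Y k\<^esub> powr p)"
    by (intro sum.cong refl) (simp add: others)
  ultimately have "\<parallel>u j\<parallel>\<^bsub>Y j\<^esub> powr p \<le> \<parallel>v j\<parallel>\<^bsub>Y j\<^esub> powr p"
    by linarith
  moreover have "0 \<le> \<parallel>v j\<parallel>\<^bsub>Y j\<^esub>"
    using normed_space.vnorm_nonneg[OF Y[OF j]] uv j by (simp add: lp_sum_simps)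
  ultimately show ?thesis
    using p powr_less_mono2[of p "\<parallel>v j\<parallel>\<^bsub>Y j\<^esub>" "\<parallel>u j\<parallel>\<^bsub>Y j\<^esub>"] by linarith
qed

lemma (in normed_space) dist_to_line_eq:
  assumes t: "t \<in> carrier V" and s: "s \<in> carrier V" and z0: "z0 \<in> F"
    and min: "\<And>c. c \<in> F \<Longrightarrow> \<parallel>t \<ominus> z0 \<odot> s\<parallel> \<le> \<parallel>(t \<ominus> z0 \<odot> s) \<oplus> c \<odot> s\<parallel>"
  shows "dist_to V t (line F V s) = \<parallel>t \<ominus> z0 \<odot> s\<parallel>"
proof (rule antisym)
  show "dist_to V t (line F V s) \<le> \<parallel>t \<ominus> z0 \<odot> s\<parallel>"
    unfolding dist_to_def
  proof (rule cINF_lower)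
    show "bdd_below ((\<lambda>w. \<parallel>t \<ominus> w\<parallel>) ` line F V s)"
      by (rule bdd_belowI2[of _ 0]) (use t s in \<open>auto simp: line_def\<close>)
  qed (use z0 in \<open>auto simp: line_def\<close>)
  show "\<parallel>t \<ominus> z0 \<odot> s\<parallel> \<le> dist_to V t (line F V s)"
    unfolding dist_to_def
  proof (rule cINF_greatest)
    fix w assume "w \<in> line F V s"
    then obtain c where c: "c \<in> F" "w = c \<odot> s" by (auto simp: line_def)
    have "(t \<ominus> z0 \<odot> s) \<oplus> (z0 - c) \<odot> s = t \<oplus> ((- z0) \<odot> s \<oplus> (z0 - c) \<odot> s)"
      using t s z0 c by (simp add: minus_as_smult smult_simps(3) a_assoc)
    also have "\<dots> = t \<ominus> w"
      using t s z0 c smult_simps(2)[of "- z0" "z0 - c" s] by (simp add: minus_as_smult smult_simps(3))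
    finally show "\<parallel>t \<ominus> z0 \<odot> s\<parallel> \<le> \<parallel>t \<ominus> w\<parallel>"
      using min[of "z0 - c"] z0 c by simp
  qed (use z0 in \<open>auto simp: line_def\<close>)
qed

locale lp_operators =
  fixes F :: "complex set" and p :: real and d :: nat
    and X :: "'a normed_module" and Y :: "nat \<Rightarrow> 'b normed_module"
  assumes p_ge_1: "1 \<le> p" and normed_X: "normed_space F X"
    and normed_Y: "\<And>k. k \<in> {1..d} \<Longrightarrow> normed_space F (Y k)"
begin

abbreviation W where "W \<equiv> lp_sum p d Y"
abbreviation K where "K \<equiv> compact_op_space F X W"

sublocale normed_space_pair F X W
  by (intro normed_space_pair.intro normed_lp_sum normed_X normed_Y p_ge_1 normed_space.scalar_field[OF normed_X])

sublocale K: normed_space F K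
  by (rule normed_compact_op_space)

lemma K_simps:
  "carrier K = compact_ops F X W" "\<parallel>A\<parallel>\<^bsub>K\<^esub> = op_norm X W A"
  "A \<oplus>\<^bsub>K\<^esub> B = add_op A B" "c \<odot>\<^bsub>K\<^esub> A = smult_op c A"
  by (simp_all add: compact_op_space_def op_space_simps)

lemma op_tuple_apply:
  assumes "op_tuple X d T \<in> carrier K" "x \<in> carrier X" "k \<in> {1..d}"
  shows "T k x \<in> carrier (Y k)"
proof -
  have "op_tuple X d T x \<in> carrier W"
    using assms linear_opsD(1)[OF compact_opsD(1)] by (simp add: K_simps)
  then show ?thesis
    using assms by (simp add: op_tuple_def lp_sum_simps)
qed

lemma op_tuple_eqI:
  assumes "\<And>x k. x \<in> carrier X \<Longrightarrow> k \<in> {1..d} \<Longrightarrow> A k x = B k x"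
  shows "op_tuple X d A = op_tuple X d B"
  using assms by (auto simp: op_tuple_def fun_eq_iff restrict_def)

lemma add_op_tuple:
  "op_tuple X d A \<oplus>\<^bsub>K\<^esub> op_tuple X d B = op_tuple X d (\<lambda>k x. A k x \<oplus>\<^bsub>Y k\<^esub> B k x)"
  by (auto simp: op_tuple_def K_simps add_op_def lp_sum_simps fun_eq_iff restrict_def)

lemma smult_op_tuple:
  "c \<odot>\<^bsub>K\<^esub> op_tuple X d A = op_tuple X d (\<lambda>k x. c \<odot>\<^bsub>Y k\<^esub> A k x)"
  by (auto simp: op_tuple_def K_simps smult_op_def lp_sum_simps fun_eq_iff restrict_def)

text \<open>
  Each coordinate is scaled by at most the sum of the moduli \<open>cmod (z k)\<close>, a bound that also makes sense
  for \<open>d = 0\<close>.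
\<close>

lemma diagonal_bounded:
  assumes z: "z \<in> {1..d} \<rightarrow> F"
  shows "(\<lambda>u\<in>carrier W. \<lambda>k\<in>{1..d}. z k \<odot>\<^bsub>Y k\<^esub> u k) \<in> bounded_ops F W W"
proof -
  interpret WW: normed_space_pair F W W by unfold_locales
  let ?R = "\<lambda>u\<in>carrier W. \<lambda>k\<in>{1..d}. z k \<odot>\<^bsub>Y k\<^esub> u k"
  define C where "C = (\<Sum>k=1..d. cmod (z k))"
  have C: "0 \<le> C" "cmod (z k) \<le> C" if "k \<in> {1..d}" for k
    unfolding C_def using that by (auto intro: sum_nonneg member_le_sum)
  have C0: "0 \<le> C" unfolding C_def by (rule sum_nonneg) simp
  have zF: "z k \<in> F" if "k \<in> {1..d}" for k using z that by blast
  note ns = normed_space.smult_simps[OF normed_Y] normed_space.vnorm_smult[OF normed_Y] normed_space.vnorm_nonneg[OF normed_Y]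
  show ?thesis
  proof (rule WW.bounded_opsI)
    show "?R \<in> linear_ops F W W"
    proof (rule WW.linear_opsI)
      show cl: "?R u \<in> carrier W" if "u \<in> carrier W" for u
        using that zF ns(1) by (simp add: lp_sum_simps)
      show "?R \<in> extensional (carrier W)" by simp
      show "?R (u \<oplus>\<^bsub>W\<^esub> v) = ?R u \<oplus>\<^bsub>W\<^esub> ?R v" if uv: "u \<in> carrier W" "v \<in> carrier W" for u v
        using uv W.a_closed[OF uv] zF ns(4) by (intro lp_sum_eqI[of _ d]) (simp_all add: lp_sum_simps)
      show "?R (c \<odot>\<^bsub>W\<^esub> u) = c \<odot>\<^bsub>W\<^esub> ?R u" if c: "c \<in> F" and u: "u \<in> carrier W" for c u
        using c u W.smult_simps(1)[OF c u] zF ns(3) by (intro lp_sum_eqI[of _ d]) (simp_all add: lp_sum_simps mult.commute)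
    qed
    fix u assume u: "u \<in> carrier W"
    have "\<parallel>?R u\<parallel>\<^bsub>W\<^esub> \<le> \<parallel>complex_of_real C \<odot>\<^bsub>W\<^esub> u\<parallel>\<^bsub>W\<^esub>"
      unfolding lp_sum_simps(5)
    proof (intro powr_mono2 sum_mono sum_nonneg)
      fix k assume k: "k \<in> {1..d}"
      have uk: "u k \<in> carrier (Y k)" using u k by (simp add: lp_sum_simps)
      show "0 \<le> \<parallel>?R u k\<parallel>\<^bsub>Y k\<^esub>"
        using u uk k zF[OF k] ns(1,9)[OF k] by simp
      show "\<parallel>?R u k\<parallel>\<^bsub>Y k\<^esub> \<le> \<parallel>(complex_of_real C \<odot>\<^bsub>W\<^esub> u) k\<parallel>\<^bsub>Y k\<^esub>"
        using u uk k zF[OF k] C(2)[OF k] C0 ns(8)[OF k] ns(9)[OF k uk]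
        by (simp add: lp_sum_simps(4) mult_right_mono)
    qed (use p_ge_1 in auto)
    also have "\<dots> = C * \<parallel>u\<parallel>\<^bsub>W\<^esub>"
      using u C0 by (simp add: W.vnorm_smult)
    finally show "\<parallel>?R u\<parallel>\<^bsub>W\<^esub> \<le> C * \<parallel>u\<parallel>\<^bsub>W\<^esub>" .
  qed
qed

lemma scaled_tuple_compact:
  assumes S: "op_tuple X d S \<in> carrier K" and z: "z \<in> {1..d} \<rightarrow> F"
  shows "op_tuple X d (scale_tuple Y z S) \<in> carrier K"
proof -
  have S': "op_tuple X d S \<in> compact_ops F X W" using S by (simp add: K_simps)
  have "(\<lambda>x\<in>carrier X. (\<lambda>u\<in>carrier W. \<lambda>k\<in>{1..d}. z k \<odot>\<^bsub>Y k\<^esub> u k) (op_tuple X d S x)) \<in> compact_ops F X W"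
    by (rule compact_ops_compose[OF S' W.normed_space_axioms diagonal_bounded[OF z]])
  also have "(\<lambda>x\<in>carrier X. (\<lambda>u\<in>carrier W. \<lambda>k\<in>{1..d}. z k \<odot>\<^bsub>Y k\<^esub> u k) (op_tuple X d S x)) = op_tuple X d (scale_tuple Y z S)"
  proof
    fix x
    show "(\<lambda>x\<in>carrier X. (\<lambda>u\<in>carrier W. \<lambda>k\<in>{1..d}. z k \<odot>\<^bsub>Y k\<^esub> u k) (op_tuple X d S x)) x = op_tuple X d (scale_tuple Y z S) x"
      using linear_opsD(1)[OF compact_opsD(1)[OF S'], of x]
      by (auto simp: op_tuple_def scale_tuple_def restrict_def fun_eq_iff)
  qed
  finally show ?thesis by (simp add: K_simps)
qed

lemma scaled_tuples_subspace:
  assumes S: "op_tuple X d S \<in> carrier K"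
  shows "scaled_tuples F X d Y S \<subseteq> carrier K" "scaled_tuples F X d Y S \<noteq> {}"
    "A \<in> scaled_tuples F X d Y S \<Longrightarrow> B \<in> scaled_tuples F X d Y S \<Longrightarrow> A \<oplus>\<^bsub>K\<^esub> B \<in> scaled_tuples F X d Y S"
    "c \<in> F \<Longrightarrow> A \<in> scaled_tuples F X d Y S \<Longrightarrow> c \<odot>\<^bsub>K\<^esub> A \<in> scaled_tuples F X d Y S"
proof -
  note Sk = op_tuple_apply[OF S]
  show "scaled_tuples F X d Y S \<subseteq> carrier K"
    using scaled_tuple_compact[OF S] by (auto simp: scaled_tuples_def)
  show "scaled_tuples F X d Y S \<noteq> {}"
    using K.scalars(1) by (auto simp: scaled_tuples_def)
  show "A \<oplus>\<^bsub>K\<^esub> B \<in> scaled_tuples F X d Y S" if AB: "A \<in> scaled_tuples F X d Y S" "B \<in> scaled_tuples F X d Y S"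
  proof -
    obtain a b where ab: "a \<in> {1..d} \<rightarrow> F" "A = op_tuple X d (scale_tuple Y a S)"
      "b \<in> {1..d} \<rightarrow> F" "B = op_tuple X d (scale_tuple Y b S)"
      using AB by (auto simp: scaled_tuples_def)
    have "A \<oplus>\<^bsub>K\<^esub> B = op_tuple X d (scale_tuple Y (\<lambda>k. a k + b k) S)"
      unfolding ab(2,4) add_op_tuple
    proof (rule op_tuple_eqI)
      fix x k assume x: "x \<in> carrier X" and k: "k \<in> {1..d}"
      have "a k \<in> F" "b k \<in> F" using ab k by auto
      then show "scale_tuple Y a S k x \<oplus>\<^bsub>Y k\<^esub> scale_tuple Y b S k x = scale_tuple Y (\<lambda>k. a k + b k) S k x"
        using normed_space.smult_simps(2)[OF normed_Y[OF k], of "a k" "b k" "S k x"] Sk[OF x k] by (simp add: scale_tuple_def)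
    qed
    moreover have "(\<lambda>k. a k + b k) \<in> {1..d} \<rightarrow> F" using ab by auto
    ultimately show ?thesis unfolding scaled_tuples_def by blast
  qed
  show "c \<odot>\<^bsub>K\<^esub> A \<in> scaled_tuples F X d Y S" if c: "c \<in> F" and A: "A \<in> scaled_tuples F X d Y S"
  proof -
    obtain a where a: "a \<in> {1..d} \<rightarrow> F" "A = op_tuple X d (scale_tuple Y a S)"
      using A by (auto simp: scaled_tuples_def)
    have "c \<odot>\<^bsub>K\<^esub> A = op_tuple X d (scale_tuple Y (\<lambda>k. c * a k) S)"
      unfolding a(2) smult_op_tuple
    proof (rule op_tuple_eqI)
      fix x k assume x: "x \<in> carrier X" and k: "k \<in> {1..d}"
      have "a k \<in> F" using a k by auto
      then show "c \<odot>\<^bsub>Y k\<^esub> scale_tuple Y a S k x = scale_tuple Y (\<lambda>k. c * a k) S k x"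
        using normed_space.smult_simps(3)[OF normed_Y[OF k] c, of "a k" "S k x"] Sk[OF x k] by (simp add: scale_tuple_def)
    qed
    moreover have "(\<lambda>k. c * a k) \<in> {1..d} \<rightarrow> F" using a c by auto
    ultimately show ?thesis unfolding scaled_tuples_def by blast
  qed
qed

lemma op_tuple_diff:
  assumes T: "op_tuple X d T \<in> carrier K" and S: "op_tuple X d S \<in> carrier K"
  shows "op_tuple X d (diff_tuple Y T S) = op_tuple X d T \<ominus>\<^bsub>K\<^esub> op_tuple X d S"
  unfolding K.minus_as_smult[OF T S] smult_op_tuple add_op_tuple
proof (rule op_tuple_eqI)
  fix x k assume "x \<in> carrier X" and k: "k \<in> {1..d}"
  then show "diff_tuple Y T S k x = T k x \<oplus>\<^bsub>Y k\<^esub> (- 1) \<odot>\<^bsub>Y k\<^esub> S k x"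
    using normed_space.minus_as_smult[OF normed_Y[OF k]] op_tuple_apply[OF T] op_tuple_apply[OF S] by (simp add: diff_tuple_def)
qed

end

theorem proposition2p1:
  fixes F :: "complex set" and p :: real and d :: nat
    and X :: "'a normed_module" and Y :: "nat \<Rightarrow> 'b normed_module"
    and T S T0 :: "nat \<Rightarrow> 'a \<Rightarrow> 'b" and z0 :: "nat \<Rightarrow> complex"
  assumes field: "F = \<real> \<or> F = UNIV"
    and p: "1 \<le> p" and d: "1 \<le> d"
    and X: "banach_space F X" "reflexive F X"
    and Y: "\<And>k. k \<in> {1..d} \<Longrightarrow> banach_space F (Y k)"
    and T: "op_tuple X d T \<in> carrier (compact_op_space F X (lp_sum p d Y))"
    and S: "op_tuple X d S \<in> carrier (compact_op_space F X (lp_sum p d Y))"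
    and T_notin: "op_tuple X d T \<notin> scaled_tuples F X d Y S"
    and z0: "\<And>k. k \<in> {1..d} \<Longrightarrow> z0 k \<in> F"
    and T0: "T0 = diff_tuple Y T (scale_tuple Y z0 S)"
    and best: "dist_to (compact_op_space F X (lp_sum p d Y)) (op_tuple X d T) (scaled_tuples F X d Y S)
                 = op_norm X (lp_sum p d Y) (op_tuple X d T0)"
    and smooth_T0: "smooth F (compact_op_space F X (lp_sum p d Y)) (op_tuple X d T0)"
  shows "\<exists>x \<in> norm_attainment X (lp_sum p d Y) (op_tuple X d T0) \<inter> ball_extreme_points X.
           (\<forall>j \<in> {1..d}. dist_to (Y j) (T j x) (line F (Y j) (S j x)) = \<parallel>T0 j x\<parallel>\<^bsub>Y j\<^esub>) \<and>
           dist_to (compact_op_space F X (lp_sum p d Y)) (op_tuple X d T) (scaled_tuples F X d Y S) powr p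
             = (\<Sum>j=1..d. dist_to (Y j) (T j x) (line F (Y j) (S j x)) powr p)"
proof -
  have Yn: "normed_space F (Y k)" if "k \<in> {1..d}" for k
    using Y[OF that] by (simp add: banach_space_def)
  have Xn: "normed_space F X"
    using X(1) by (simp add: banach_space_def)
  interpret lp_operators F p d X Y
    by (rule lp_operators.intro[OF p Xn Yn])
  let ?M = "scaled_tuples F X d Y S"
  let ?T0 = "op_tuple X d T0"
  note M = scaled_tuples_subspace[OF S]
  have z0': "z0 \<in> {1..d} \<rightarrow> F" using z0 by blast
  note S0 = scaled_tuple_compact[OF S z0']
  have S0M: "op_tuple X d (scale_tuple Y z0 S) \<in> ?M"
    using z0' by (auto simp: scaled_tuples_def)
  have T0_diff: "?T0 = op_tuple X d T \<ominus>\<^bsub>K\<^esub> op_tuple X d (scale_tuple Y z0 S)"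
    unfolding T0 by (rule op_tuple_diff[OF T S0])
  have T0K: "?T0 \<in> carrier K"
    unfolding T0_diff by (intro K.minus_closed T S0)
  have dist: "\<parallel>?T0\<parallel>\<^bsub>K\<^esub> \<le> \<parallel>op_tuple X d T \<ominus>\<^bsub>K\<^esub> A\<parallel>\<^bsub>K\<^esub>" if A: "A \<in> ?M" for A
  proof -
    have "dist_to K (op_tuple X d T) ?M \<le> \<parallel>op_tuple X d T \<ominus>\<^bsub>K\<^esub> A\<parallel>\<^bsub>K\<^esub>"
      unfolding dist_to_def
    proof (rule cINF_lower[OF bdd_belowI2[of _ 0] A])
      fix B assume "B \<in> ?M"
      then show "0 \<le> \<parallel>op_tuple X d T \<ominus>\<^bsub>K\<^esub> B\<parallel>\<^bsub>K\<^esub>"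
        using M(1) T by (intro K.vnorm_nonneg K.minus_closed) auto
    qed
    then show ?thesis
      using best by (simp add: K_simps(2))
  qed
  have "\<parallel>?T0\<parallel>\<^bsub>K\<^esub> \<le> \<parallel>?T0 \<oplus>\<^bsub>K\<^esub> A\<parallel>\<^bsub>K\<^esub>" if A: "A \<in> ?M" for A
  proof -
    \<comment> \<open>\<open>?T0 \<oplus> A\<close> is the difference of \<open>op_tuple X d T\<close> and another scaled tuple.\<close>
    let ?B = "op_tuple X d (scale_tuple Y z0 S) \<oplus>\<^bsub>K\<^esub> (-1) \<odot>\<^bsub>K\<^esub> A"
    have AK: "A \<in> carrier K" using A M(1) by blast
    have B: "?B \<in> ?M"
      by (intro M S0M A) simp
    have "op_tuple X d T \<ominus>\<^bsub>K\<^esub> ?B = ?T0 \<oplus>\<^bsub>K\<^esub> A"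
      unfolding T0_diff using T S0 AK
      by (simp add: K.neg_one_smult K.minus_eq K.minus_add K.a_assoc K.minus_minus)
    then show ?thesis
      using dist[OF B] by simp
  qed
  from smooth_best_approximation_pointwise[OF X(2) smooth_T0 M(1) M(2) M(3) M(4) this]
  obtain x where x: "x \<in> norm_attainment X W ?T0" "x \<in> ball_extreme_points X"
    and pointwise: "\<And>A. A \<in> ?M \<Longrightarrow> \<parallel>?T0 x\<parallel>\<^bsub>W\<^esub> \<le> \<parallel>?T0 x \<oplus>\<^bsub>W\<^esub> A x\<parallel>\<^bsub>W\<^esub>"
    by blast
  have xX: "x \<in> carrier X"
    using x(1) by (simp add: norm_attainment_def unit_sphere_def)
  have cl: "A x \<in> carrier W" if "A \<in> carrier K" for A
    using that linear_opsD(1)[OF compact_opsD(1) xX] by (simp add: K_simps)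
  have coords: "dist_to (Y j) (T j x) (line F (Y j) (S j x)) = \<parallel>T0 j x\<parallel>\<^bsub>Y j\<^esub>" if j: "j \<in> {1..d}" for j
  proof -
    have Tj: "T j x \<in> carrier (Y j)" and Sj: "S j x \<in> carrier (Y j)"
      using op_tuple_apply[OF T xX j] op_tuple_apply[OF S xX j] .
    have T0j: "T0 j x = T j x \<ominus>\<^bsub>Y j\<^esub> z0 j \<odot>\<^bsub>Y j\<^esub> S j x"
      by (simp add: T0 diff_tuple_def scale_tuple_def)
    have "\<parallel>T0 j x\<parallel>\<^bsub>Y j\<^esub> \<le> \<parallel>T0 j x \<oplus>\<^bsub>Y j\<^esub> c \<odot>\<^bsub>Y j\<^esub> S j x\<parallel>\<^bsub>Y j\<^esub>" if c: "c \<in> F" for c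
    proof -
      \<comment> \<open>A scaled tuple concentrated in coordinate \<open>j\<close> leaves the other coordinates of \<open>?T0 x\<close> unchanged.\<close>
      define A where "A = op_tuple X d (scale_tuple Y (\<lambda>k. if k = j then c else 0) S)"
      have A: "A \<in> ?M" unfolding A_def scaled_tuples_def using c K.scalars(1) by auto
      have AK: "A \<in> carrier K" using A M(1) by blast
      have "\<parallel>?T0 x j\<parallel>\<^bsub>Y j\<^esub> \<le> \<parallel>(?T0 x \<oplus>\<^bsub>W\<^esub> A x) j\<parallel>\<^bsub>Y j\<^esub>"
      proof (rule lp_coordinate_norm_le[OF p Yn _ _ pointwise[OF A] j])
        fix k assume k: "k \<in> {1..d}" "k \<noteq> j"
        interpret Yk: normed_space F "Y k" by (rule Yn[OF k(1)])
        show "(?T0 x \<oplus>\<^bsub>W\<^esub> A x) k = ?T0 x k"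
          using k xX op_tuple_apply[OF T0K xX k(1)] op_tuple_apply[OF S xX k(1)]
          by (simp add: A_def op_tuple_def lp_sum_simps scale_tuple_def Yk.smult_simps)
      qed (use cl[OF T0K] cl[OF AK] in auto)
      then show ?thesis
        using j xX by (simp add: A_def op_tuple_def lp_sum_simps scale_tuple_def)
    qed
    then show ?thesis
      unfolding T0j by (intro normed_space.dist_to_line_eq[OF Yn[OF j]] Tj Sj z0 j)
  qed
  have "op_norm X W ?T0 powr p = \<parallel>?T0 x\<parallel>\<^bsub>W\<^esub> powr p"
    using x(1) by (simp add: norm_attainment_def)
  also have "\<dots> = (\<Sum>j=1..d. \<parallel>T0 j x\<parallel>\<^bsub>Y j\<^esub> powr p)"
    unfolding lp_norm_powr[OF p] using xX by (simp add: op_tuple_def)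
  finally have "dist_to K (op_tuple X d T) ?M powr p = (\<Sum>j=1..d. dist_to (Y j) (T j x) (line F (Y j) (S j x)) powr p)"
    unfolding best by (simp add: coords)
  then show ?thesis
    using x coords by blast
qed

end
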